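(* Let $\mathcal{C}$ be a $2$-Calabi-Yau triangulated category, let $\mathcal{R}$ be a functorially finite maximal rigid subcategory of $\mathcal{C}$, and let $\mathcal{R}'$ be another functorially finite maximal rigid subcategory of $\mathcal{C}$. Then the elements $\mathrm{ind}_{\mathcal{R}}(R')$, where $R'$ runs through a system of representatives of the isomorphism classes of indecomposable objects of $\mathcal{R}'$, form a basis of the free abelian group $K_0^{\mathrm{split}}(\mathcal{R})$.
   Context: Let $k$ be an algebraically closed field. $\mathcal{C}$ is a $k$-linear triangulated category with shift functor $[1]$, which is Hom-finite and Krull-Remak-Schmidt. Put $\mathrm{Ext}^n(X,Y)=\mathrm{Hom}(X,Y[n])$. $\mathcal{C}$ is called $2$-Calabi-Yau ($2$-CY) if there are bifunctorial isomorphisms $\mathrm{Ext}^1(X,Y)\cong D\,\mathrm{Ext}^1(Y,X)$ for $X,Y\in\mathcal{C}$, where $D=\mathrm{Hom}_k(-,k)$. Subcategories are full and closed under isomorphism. A morphism $f:T\to X$ with $T\in\mathcal{T}$ is a right $\mathcal{T}$-approximation of $X$ if every morphism from an object of $\mathcal{T}$ to $X$ factors through $f$; $\mathcal{T}$ is contravariantly finite if every object of $\mathcal{C}$ has a right $\mathcal{T}$-approximation. Left approximations and covariantly finite subcategories are defined dually; $\mathcal{T}$ is functorially finite if it is both. Let $\mathcal{T}$ be a subcategory closed under direct summands and finite direct sums. $\mathcal{T}$ is rigid if $\mathrm{Ext}^1(T,T')=0$ for all $T,T'\in\mathcal{T}$; it is maximal rigid if it is rigid and, whenever $\mathrm{Ext}^1(\mathcal{T}\cup\mathrm{add}\,M,\mathcal{T}\cup\mathrm{add}\,M)=0$,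 one has $M\in\mathcal{T}$ (here $\mathrm{add}\,M$ is the subcategory of direct summands of finite direct sums of copies of $M$). An object $X$ is rigid if $\mathrm{Ext}^1(X,X)=0$. The split Grothendieck group $K_0^{\mathrm{split}}(\mathcal{R})$ is the free abelian group with basis the classes $[R]$, where $R$ runs through representatives of the isomorphism classes of indecomposable objects of $\mathcal{R}$ (with $[R\oplus R'']=[R]+[R'']$ for general objects). It is known that for every rigid object $X$ of $\mathcal{C}$ there is a triangle $R_1\to R_0\to X\to R_1[1]$ with $R_0,R_1\in\mathcal{R}$; the index of $X$ is $\mathrm{ind}_{\mathcal{R}}(X)=[R_0]-[R_1]\in K_0^{\mathrm{split}}(\mathcal{R})$, which does not depend on the choice of triangle. *)

theory Defs
  imports "HOL-Computational_Algebra.Polynomial" "HOL-Algebra.Free_Abelian_Groups"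
begin

text \<open>
  The objects are the elements of the type \<open>'o\<close>. All Hom spaces are subspaces of one
  \<open>'k\<close>-vector space \<open>'m\<close>, and only the values of composition and shift on
  these subspaces are constrained. Nothing is lost: given an arbitrary family of Hom spaces, take
  for \<open>'m\<close> their direct sum, on which a single composition and a single shift map
  suffice. Every Hom space is mentioned together with its source and target, so different Hom
  spaces need not be disjoint.
\<close>

record ('k, 'o, 'm) tricat =
  Hom :: "'o \<Rightarrow> 'o \<Rightarrow> 'm set"
  comp :: "'m \<Rightarrow> 'm \<Rightarrow> 'm"  (infixl \<open>\<cdot>\<index>\<close> 70)
  ident :: "'o \<Rightarrow> 'm"
  scal :: "'k \<Rightarrow> 'm \<Rightarrow> 'm"
  shift :: "'o \<Rightarrow> 'o"
  shift_mor :: "'m \<Rightarrow> 'm"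
  triangle :: "'o \<Rightarrow> 'o \<Rightarrow> 'o \<Rightarrow> 'm \<Rightarrow> 'm \<Rightarrow> 'm \<Rightarrow> bool"
    \<comment> \<open>\<open>triangle C X Y Z f g h\<close>: the sequence \<open>X \<rightarrow> Y \<rightarrow> Z \<rightarrow> X[1]\<close> given by
       \<open>f\<close>, \<open>g\<close>, \<open>h\<close> is distinguished\<close>


subsection \<open>Linear categories\<close>

locale linear_category =
  fixes C :: "('k::field, 'o, 'm::ab_group_add) tricat" (structure)
  assumes vector_space_scal: "vector_space (scal C)"
    and subspace_Hom: "module.subspace (scal C) (Hom C X Y)"
    and comp_closed: "\<lbrakk>f \<in> Hom C X Y; g \<in> Hom C Y Z\<rbrakk> \<Longrightarrow> g \<cdot> f \<in> Hom C X Z"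
    and comp_assoc: "\<lbrakk>f \<in> Hom C W X; g \<in> Hom C X Y; h \<in> Hom C Y Z\<rbrakk>
          \<Longrightarrow> h \<cdot> g \<cdot> f = h \<cdot> (g \<cdot> f)"
    and ident_closed: "ident C X \<in> Hom C X X"
    and ident_left: "f \<in> Hom C X Y \<Longrightarrow> ident C Y \<cdot> f = f"
    and ident_right: "f \<in> Hom C X Y \<Longrightarrow> f \<cdot> ident C X = f"
    and comp_add_left: "\<lbrakk>f \<in> Hom C X Y; g \<in> Hom C Y Z; g' \<in> Hom C Y Z\<rbrakk>
          \<Longrightarrow> (g + g') \<cdot> f = g \<cdot> f + g' \<cdot> f"
    and comp_add_right: "\<lbrakk>f \<in> Hom C X Y; f' \<in> Hom C X Y; g \<in> Hom C Y Z\<rbrakk>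
          \<Longrightarrow> g \<cdot> (f + f') = g \<cdot> f + g \<cdot> f'"
    and comp_scal_left: "\<lbrakk>f \<in> Hom C X Y; g \<in> Hom C Y Z\<rbrakk>
          \<Longrightarrow> scal C c g \<cdot> f = scal C c (g \<cdot> f)"
    and comp_scal_right: "\<lbrakk>f \<in> Hom C X Y; g \<in> Hom C Y Z\<rbrakk>
          \<Longrightarrow> g \<cdot> scal C c f = scal C c (g \<cdot> f)"

definition is_iso :: "('k, 'o, 'm) tricat \<Rightarrow> 'o \<Rightarrow> 'o \<Rightarrow> 'm \<Rightarrow> bool" where
  "is_iso C X Y f \<longleftrightarrow> f \<in> Hom C X Y \<and>
     (\<exists>g\<in>Hom C Y X. g \<cdot>\<^bsub>C\<^esub> f = ident C X \<and> f \<cdot>\<^bsub>C\<^esub> g = ident C Y)"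

definition isomorphic :: "('k, 'o, 'm) tricat \<Rightarrow> 'o \<Rightarrow> 'o \<Rightarrow> bool" where
  "isomorphic C X Y \<longleftrightarrow> (\<exists>f. is_iso C X Y f)"

definition zero_object :: "('k, 'o, 'm::zero) tricat \<Rightarrow> 'o \<Rightarrow> bool" where
  "zero_object C Z \<longleftrightarrow> (\<forall>X. Hom C Z X = {0} \<and> Hom C X Z = {0})"

text \<open>For the empty list this says that the identity of \<open>X\<close> is zero, i.e. that \<open>X\<close> is a zero object.\<close>

definition direct_sum :: "('k, 'o, 'm::ab_group_add) tricat \<Rightarrow> 'o \<Rightarrow> 'o list \<Rightarrow> bool" where
  "direct_sum C X Ys \<longleftrightarrow> (\<exists>i p.
     (\<forall>a<length Ys. i a \<in> Hom C (Ys ! a) X \<and> p a \<in> Hom C X (Ys ! a)) \<and>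
     (\<forall>a<length Ys. \<forall>b<length Ys. p b \<cdot>\<^bsub>C\<^esub> i a = (if a = b then ident C (Ys ! a) else 0)) \<and>
     (\<Sum>a<length Ys. i a \<cdot>\<^bsub>C\<^esub> p a) = ident C X)"

definition direct_summand :: "('k, 'o, 'm::ab_group_add) tricat \<Rightarrow> 'o \<Rightarrow> 'o \<Rightarrow> bool" where
  "direct_summand C Y X \<longleftrightarrow> (\<exists>Y'. direct_sum C X [Y, Y'])"

definition indecomposable :: "('k, 'o, 'm::ab_group_add) tricat \<Rightarrow> 'o \<Rightarrow> bool" where
  "indecomposable C X \<longleftrightarrow> \<not> zero_object C X \<and>
     (\<forall>Y Y'. direct_sum C X [Y, Y'] \<longrightarrow> zero_object C Y \<or> zero_object C Y')"

definition local_endomorphism_ring :: "('k, 'o, 'm::ab_group_add) tricat \<Rightarrow> 'o \<Rightarrow> bool" where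
  "local_endomorphism_ring C X \<longleftrightarrow> ident C X \<noteq> 0 \<and>
     (\<forall>f\<in>Hom C X X. \<forall>g\<in>Hom C X X. is_iso C X X (f + g) \<longrightarrow> is_iso C X X f \<or> is_iso C X X g)"

definition hom_finite :: "('k::field, 'o, 'm::ab_group_add) tricat \<Rightarrow> bool" where
  "hom_finite C \<longleftrightarrow> (\<forall>X Y. \<exists>B. finite B \<and> module.span (scal C) B = Hom C X Y)"

definition krull_remak_schmidt :: "('k, 'o, 'm::ab_group_add) tricat \<Rightarrow> bool" where
  "krull_remak_schmidt C \<longleftrightarrow>
     (\<forall>X. \<exists>Ys. direct_sum C X Ys \<and> (\<forall>Y\<in>set Ys. local_endomorphism_ring C Y))"


subsection \<open>Triangulated categories\<close>

text \<open>The shift is only required to be an autoequivalence, not a strict automorphism.\<close>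

locale triangulated_category = linear_category +
  assumes finite_direct_sums: "\<exists>X. direct_sum C X Ys"
    and shift_bij: "bij_betw (shift_mor C) (Hom C X Y) (Hom C (shift C X) (shift C Y))"
    and shift_add: "\<lbrakk>f \<in> Hom C X Y; f' \<in> Hom C X Y\<rbrakk>
          \<Longrightarrow> shift_mor C (f + f') = shift_mor C f + shift_mor C f'"
    and shift_scal: "f \<in> Hom C X Y \<Longrightarrow> shift_mor C (scal C x f) = scal C x (shift_mor C f)"
    and shift_ident: "shift_mor C (ident C X) = ident C (shift C X)"
    and shift_comp: "\<lbrakk>f \<in> Hom C X Y; g \<in> Hom C Y Z\<rbrakk>
          \<Longrightarrow> shift_mor C (g \<cdot> f) = shift_mor C g \<cdot> shift_mor C f"
    and shift_ess_surj: "\<exists>X. isomorphic C (shift C X) Y"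
    and triangle_Hom: "triangle C X Y Z f g h
          \<Longrightarrow> f \<in> Hom C X Y \<and> g \<in> Hom C Y Z \<and> h \<in> Hom C Z (shift C X)"
    and TR1_iso: "\<lbrakk>triangle C X Y Z f g h;
            f' \<in> Hom C X' Y'; g' \<in> Hom C Y' Z'; h' \<in> Hom C Z' (shift C X');
            is_iso C X X' a; is_iso C Y Y' b; is_iso C Z Z' c;
            b \<cdot> f = f' \<cdot> a; c \<cdot> g = g' \<cdot> b; shift_mor C a \<cdot> h = h' \<cdot> c\<rbrakk>
          \<Longrightarrow> triangle C X' Y' Z' f' g' h'"
    and TR1_ident: "zero_object C Z \<Longrightarrow> triangle C X X Z (ident C X) 0 0"
    and TR1_cone: "f \<in> Hom C X Y \<Longrightarrow> \<exists>Z g h. triangle C X Y Z f g h"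
    and TR2: "f \<in> Hom C X Y
          \<Longrightarrow> triangle C X Y Z f g h \<longleftrightarrow> triangle C Y Z (shift C X) g h (- shift_mor C f)"
    and TR3: "\<lbrakk>triangle C X Y Z f g h; triangle C X' Y' Z' f' g' h';
            a \<in> Hom C X X'; b \<in> Hom C Y Y'; b \<cdot> f = f' \<cdot> a\<rbrakk>
          \<Longrightarrow> \<exists>c\<in>Hom C Z Z'. c \<cdot> g = g' \<cdot> b \<and> shift_mor C a \<cdot> h = h' \<cdot> c"
    and TR4: "\<lbrakk>triangle C X Y Z' f u u'; triangle C Y Z X' g v v';
            triangle C X Z Y' (g \<cdot> f) w w'\<rbrakk>
          \<Longrightarrow> \<exists>a b. triangle C Z' Y' X' a b (shift_mor C u \<cdot> v') \<and>
                a \<cdot> u = w \<cdot> g \<and> w' \<cdot> a = u' \<and> b \<cdot> w = v \<and> v' \<cdot> b = shift_mor C f \<cdot> w'"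

definition Ext1 :: "('k, 'o, 'm) tricat \<Rightarrow> 'o \<Rightarrow> 'o \<Rightarrow> 'm set" where
  "Ext1 C X Y = Hom C X (shift C Y)"

text \<open>Linear forms on the subspace \<open>V\<close>, represented by functions that are undefined outside \<open>V\<close>.\<close>

definition dual_space :: "('k::field \<Rightarrow> 'm \<Rightarrow> 'm) \<Rightarrow> 'm::ab_group_add set \<Rightarrow> ('m \<Rightarrow> 'k) set" where
  "dual_space s V = {\<phi> \<in> extensional V.
     (\<forall>x\<in>V. \<forall>y\<in>V. \<phi> (x + y) = \<phi> x + \<phi> y) \<and> (\<forall>c. \<forall>x\<in>V. \<phi> (s c x) = c * \<phi> x)}"

text \<open>
  The last clause is naturality: \<open>f : X' \<rightarrow> X\<close> and \<open>g : Y \<rightarrow> Y'\<close> act on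
  \<open>Ext1 X Y\<close> by \<open>e \<mapsto> g[1] e f\<close>, and on the dual of \<open>Ext1 Y X\<close> by transposing
  \<open>t \<mapsto> f[1] t g\<close>.
\<close>

definition two_calabi_yau :: "('k::field, 'o, 'm::ab_group_add) tricat \<Rightarrow> bool" where
  "two_calabi_yau C \<longleftrightarrow> (\<exists>\<Phi> :: 'o \<Rightarrow> 'o \<Rightarrow> 'm \<Rightarrow> ('m \<Rightarrow> 'k).
     (\<forall>X Y. bij_betw (\<Phi> X Y) (Ext1 C X Y) (dual_space (scal C) (Ext1 C Y X))) \<and>
     (\<forall>X Y. \<forall>e\<in>Ext1 C X Y. \<forall>e'\<in>Ext1 C X Y. \<forall>t\<in>Ext1 C Y X.
        \<Phi> X Y (e + e') t = \<Phi> X Y e t + \<Phi> X Y e' t) \<and>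
     (\<forall>X Y c. \<forall>e\<in>Ext1 C X Y. \<forall>t\<in>Ext1 C Y X. \<Phi> X Y (scal C c e) t = c * \<Phi> X Y e t) \<and>
     (\<forall>X Y X' Y'. \<forall>f\<in>Hom C X' X. \<forall>g\<in>Hom C Y Y'. \<forall>e\<in>Ext1 C X Y. \<forall>t\<in>Ext1 C Y' X'.
        \<Phi> X' Y' (shift_mor C g \<cdot>\<^bsub>C\<^esub> e \<cdot>\<^bsub>C\<^esub> f) t = \<Phi> X Y e (shift_mor C f \<cdot>\<^bsub>C\<^esub> t \<cdot>\<^bsub>C\<^esub> g)))"


subsection \<open>Approximations and rigid subcategories\<close>

text \<open>Full subcategories are given by their sets of objects.\<close>

definition contravariantly_finite :: "('k, 'o, 'm) tricat \<Rightarrow> 'o set \<Rightarrow> bool" where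
  "contravariantly_finite C \<T> \<longleftrightarrow> (\<forall>X. \<exists>T\<in>\<T>. \<exists>f\<in>Hom C T X.
     \<forall>T'\<in>\<T>. \<forall>f'\<in>Hom C T' X. \<exists>g\<in>Hom C T' T. f' = f \<cdot>\<^bsub>C\<^esub> g)"

definition covariantly_finite :: "('k, 'o, 'm) tricat \<Rightarrow> 'o set \<Rightarrow> bool" where
  "covariantly_finite C \<T> \<longleftrightarrow> (\<forall>X. \<exists>T\<in>\<T>. \<exists>f\<in>Hom C X T.
     \<forall>T'\<in>\<T>. \<forall>f'\<in>Hom C X T'. \<exists>g\<in>Hom C T T'. f' = g \<cdot>\<^bsub>C\<^esub> f)"

definition functorially_finite :: "('k, 'o, 'm) tricat \<Rightarrow> 'o set \<Rightarrow> bool" where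
  "functorially_finite C \<T> \<longleftrightarrow> contravariantly_finite C \<T> \<and> covariantly_finite C \<T>"

definition additive_subcategory :: "('k, 'o, 'm::ab_group_add) tricat \<Rightarrow> 'o set \<Rightarrow> bool" where
  "additive_subcategory C \<T> \<longleftrightarrow>
     (\<forall>X Y. X \<in> \<T> \<longrightarrow> isomorphic C X Y \<longrightarrow> Y \<in> \<T>) \<and>
     (\<forall>X Ys. set Ys \<subseteq> \<T> \<longrightarrow> direct_sum C X Ys \<longrightarrow> X \<in> \<T>) \<and>
     (\<forall>X Y. X \<in> \<T> \<longrightarrow> direct_summand C Y X \<longrightarrow> Y \<in> \<T>)"

definition add_closure :: "('k, 'o, 'm::ab_group_add) tricat \<Rightarrow> 'o \<Rightarrow> 'o set" where
  "add_closure C M = {Y. \<exists>X n. direct_sum C X (replicate n M) \<and> direct_summand C Y X}"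

definition Ext1_vanishes :: "('k, 'o, 'm::zero) tricat \<Rightarrow> 'o set \<Rightarrow> bool" where
  "Ext1_vanishes C \<T> \<longleftrightarrow> (\<forall>T\<in>\<T>. \<forall>T'\<in>\<T>. Ext1 C T T' = {0})"

definition rigid_subcategory :: "('k, 'o, 'm::ab_group_add) tricat \<Rightarrow> 'o set \<Rightarrow> bool" where
  "rigid_subcategory C \<T> \<longleftrightarrow> additive_subcategory C \<T> \<and> Ext1_vanishes C \<T>"

definition maximal_rigid :: "('k, 'o, 'm::ab_group_add) tricat \<Rightarrow> 'o set \<Rightarrow> bool" where
  "maximal_rigid C \<T> \<longleftrightarrow> rigid_subcategory C \<T> \<and>
     (\<forall>M. Ext1_vanishes C (\<T> \<union> add_closure C M) \<longrightarrow> M \<in> \<T>)"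


subsection \<open>The split Grothendieck group and the index\<close>

definition iso_class :: "('k, 'o, 'm) tricat \<Rightarrow> 'o \<Rightarrow> 'o set" where
  "iso_class C X = {Y. isomorphic C X Y}"

definition K0_split :: "('k, 'o, 'm::ab_group_add) tricat \<Rightarrow> 'o set \<Rightarrow> ('o set \<Rightarrow>\<^sub>0 int) monoid" where
  "K0_split C \<R> = free_Abelian_group (iso_class C ` {X \<in> \<R>. indecomposable C X})"

text \<open>The Krull-Remak-Schmidt theorem makes this independent of the chosen decomposition.\<close>

definition K0_class :: "('k, 'o, 'm::ab_group_add) tricat \<Rightarrow> 'o \<Rightarrow> ('o set \<Rightarrow>\<^sub>0 int)" where
  "K0_class C X = (SOME v. \<exists>Ys. direct_sum C X Ys \<and> (\<forall>Y\<in>set Ys. indecomposable C Y) \<and>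
     v = (\<Sum>Y\<leftarrow>Ys. frag_of (iso_class C Y)))"

text \<open>
  The index is meaningful only for objects \<open>X\<close> admitting such a triangle (for maximal rigid,
  functorially finite \<open>\<R>\<close>, these include all rigid ones); it then does not depend on the choice.
\<close>

definition ind :: "('k, 'o, 'm::ab_group_add) tricat \<Rightarrow> 'o set \<Rightarrow> 'o \<Rightarrow> ('o set \<Rightarrow>\<^sub>0 int)" where
  "ind C \<R> X = (SOME v. \<exists>R\<^sub>0\<in>\<R>. \<exists>R\<^sub>1\<in>\<R>. \<exists>f g h.
     triangle C R\<^sub>1 R\<^sub>0 X f g h \<and> v = K0_class C R\<^sub>0 - K0_class C R\<^sub>1)"

definition indec_representatives :: "('k, 'o, 'm::ab_group_add) tricat \<Rightarrow> 'o set \<Rightarrow> 'o set \<Rightarrow> bool" where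
  "indec_representatives C \<T> I \<longleftrightarrow> I \<subseteq> {X \<in> \<T>. indecomposable C X} \<and>
     (\<forall>X\<in>\<T>. indecomposable C X \<longrightarrow> (\<exists>!Y. Y \<in> I \<and> isomorphic C X Y))"

lemma module_frag_cmul: "module frag_cmul"
  by standard (simp_all add: frag_cmul_distrib frag_cmul_distrib2)

text \<open>
  A family \<open>(b i)\<close>, \<open>i \<in> I\<close>, is a basis of the subgroup underlying \<open>G\<close>: as a family, i.e. its
  members are also pairwise distinct.
\<close>

definition is_int_basis :: "('i \<Rightarrow> ('a \<Rightarrow>\<^sub>0 int)) \<Rightarrow> 'i set \<Rightarrow> ('a \<Rightarrow>\<^sub>0 int) monoid \<Rightarrow> bool" where
  "is_int_basis b I G \<longleftrightarrow> inj_on b I \<and> module.independent frag_cmul (b ` I) \<and>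
     module.span frag_cmul (b ` I) = carrier G"

end

theory Submission
  imports Defs "HOL-Combinatorics.Transposition"
begin

text \<open>
  The assignment \<open>[Y] \<mapsto> ind\<^bsub>\<R>\<^esub>(Y)\<close> extends to a homomorphism
  \<open>\<phi> : K\<^sub>0(\<R>') \<rightarrow> K\<^sub>0(\<R>)\<close>, and the claim is that \<open>\<phi>\<close> is bijective. Its inverse is
  \<open>\<psi> : [X] \<mapsto> - ind\<^bsub>\<R>'\<^esub>(X[1])\<close>, the coindex with respect to \<open>\<R>'\<close>.

  Both \<open>\<phi> \<psi> = 1\<close> and \<open>\<psi> \<phi> = 1\<close> are instances of one additivity property
  (\<open>has_index_extension\<close>): for a triangle \<open>X \<rightarrow> Y \<rightarrow> Z \<rightarrow> X[1]\<close> with \<open>X\<close> in \<open>\<R>\<close>,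
  an index of \<open>Z\<close> yields the index \<open>[X] + ind(Z)\<close> of \<open>Y\<close>. Indeed a presentation
  \<open>S\<^sub>1 \<rightarrow> S\<^sub>0 \<rightarrow> Z\<close> of \<open>Z\<close> by \<open>\<R>\<close> pulls back along \<open>Y \<rightarrow> Z\<close>, and the pullback of
  \<open>S\<^sub>0\<close> is \<open>X \<oplus> S\<^sub>0\<close> because the composite \<open>S\<^sub>0 \<rightarrow> Z \<rightarrow> X[1]\<close> vanishes by rigidity.

  \<^item> A presentation \<open>A \<rightarrow> B \<rightarrow> X[1]\<close> by \<open>\<R>'\<close> of the shift of some \<open>X\<close> in \<open>\<R>\<close> rotates to
    \<open>X \<rightarrow> A \<rightarrow> B \<rightarrow> X[1]\<close>, so \<open>[X] = ind\<^bsub>\<R>\<^esub>(A) - ind\<^bsub>\<R>\<^esub>(B)\<close>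
    (\<open>K0_class_as_index_difference\<close>). Hence the indices generate.
  \<^item> A presentation \<open>R\<^sub>1 \<rightarrow> R\<^sub>0 \<rightarrow> Y\<close> by \<open>\<R>\<close> of some \<open>Y\<close> in \<open>\<R>'\<close> rotates to
    \<open>Y \<rightarrow> R\<^sub>1[1] \<rightarrow> R\<^sub>0[1] \<rightarrow> Y[1]\<close>, so \<open>[Y] = ind\<^bsub>\<R>'\<^esub>(R\<^sub>1[1]) - ind\<^bsub>\<R>'\<^esub>(R\<^sub>0[1])\<close>
    (\<open>K0_class_as_shifted_index_difference\<close>). Hence \<open>\<psi>\<close> recovers \<open>[Y]\<close> from its index
    (\<open>index_left_inverse\<close>), and the indices are linearly independent.

  This rests on four facts about indices and classes: every rigid object has a presentation
  (\<open>rigid_presentation\<close>, where the Calabi-Yau property and maximality enter), two presentations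
  give the same index (\<open>has_index_unique\<close>), the index is additive on direct sums
  (\<open>has_index_direct_sum\<close>), and decompositions into indecomposables are unique
  (\<open>decomposition_unique\<close>).
\<close>

section \<open>Linear categories\<close>

context linear_category
begin

lemmas module_scal = vector_space_scal[folded module_iff_vector_space]

lemma zero_Hom [simp]: "0 \<in> Hom C X Y"
  by (rule module.subspace_0[OF module_scal subspace_Hom])

lemma add_Hom: "f \<in> Hom C X Y \<Longrightarrow> g \<in> Hom C X Y \<Longrightarrow> f + g \<in> Hom C X Y"
  by (rule module.subspace_add[OF module_scal subspace_Hom])

lemma minus_Hom: "f \<in> Hom C X Y \<Longrightarrow> - f \<in> Hom C X Y"
  by (rule module.subspace_neg[OF module_scal subspace_Hom])

lemma diff_Hom: "f \<in> Hom C X Y \<Longrightarrow> g \<in> Hom C X Y \<Longrightarrow> f - g \<in> Hom C X Y"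
  using add_Hom[of f X Y "- g"] minus_Hom by simp

lemma sum_Hom: "(\<And>a. a \<in> A \<Longrightarrow> f a \<in> Hom C X Y) \<Longrightarrow> sum f A \<in> Hom C X Y"
  by (induction A rule: infinite_finite_induct) (auto intro: add_Hom)

lemma comp_zero_left [simp]: "f \<in> Hom C X Y \<Longrightarrow> 0 \<cdot> f = 0"
  using comp_add_left[of f X Y 0 Y 0] by simp

lemma comp_zero_right [simp]: "g \<in> Hom C Y Z \<Longrightarrow> g \<cdot> 0 = 0"
  using comp_add_right[of 0 Y Y 0 g Z] by simp

lemma comp_minus_left: "f \<in> Hom C X Y \<Longrightarrow> g \<in> Hom C Y Z \<Longrightarrow> (- g) \<cdot> f = - (g \<cdot> f)"
  using comp_add_left[of f X Y g Z "- g"] minus_Hom[of g Y Z] minus_unique[of "g \<cdot> f" "(- g) \<cdot> f"]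
  by simp

lemma comp_minus_right: "f \<in> Hom C X Y \<Longrightarrow> g \<in> Hom C Y Z \<Longrightarrow> g \<cdot> (- f) = - (g \<cdot> f)"
  using comp_add_right[of f X Y "- f" g Z] minus_Hom[of f X Y] minus_unique[of "g \<cdot> f" "g \<cdot> (- f)"]
  by simp

lemma comp_diff_left:
  "f \<in> Hom C X Y \<Longrightarrow> g \<in> Hom C Y Z \<Longrightarrow> g' \<in> Hom C Y Z \<Longrightarrow> (g - g') \<cdot> f = g \<cdot> f - g' \<cdot> f"
  using comp_add_left[of f X Y g Z "- g'"] comp_minus_left minus_Hom by simp

lemma comp_diff_right:
  "f \<in> Hom C X Y \<Longrightarrow> f' \<in> Hom C X Y \<Longrightarrow> g \<in> Hom C Y Z \<Longrightarrow> g \<cdot> (f - f') = g \<cdot> f - g \<cdot> f'"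
  using comp_add_right[of f X Y "- f'" g Z] comp_minus_right minus_Hom by simp

lemma comp_sum_left:
  assumes "f \<in> Hom C X Y" "\<And>a. a \<in> A \<Longrightarrow> g a \<in> Hom C Y Z"
  shows "sum g A \<cdot> f = (\<Sum>a\<in>A. g a \<cdot> f)"
  using assms
  by (induction A rule: infinite_finite_induct) (auto simp: comp_add_left[of f X Y _ Z] sum_Hom)

lemma comp_sum_right:
  assumes "\<And>a. a \<in> A \<Longrightarrow> f a \<in> Hom C X Y" "g \<in> Hom C Y Z"
  shows "g \<cdot> sum f A = (\<Sum>a\<in>A. g \<cdot> f a)"
  using assms
  by (induction A rule: infinite_finite_induct) (auto simp: comp_add_right[of _ X Y _ g Z] sum_Hom)

lemma sum_comp_both:
  assumes h: "\<And>a. a \<in> A \<Longrightarrow> h a \<in> Hom C X Y" and g: "g \<in> Hom C W X" and f: "f \<in> Hom C Y Z"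
  shows "(\<Sum>a\<in>A. f \<cdot> h a \<cdot> g) = f \<cdot> sum h A \<cdot> g"
proof -
  have "f \<cdot> h a \<in> Hom C X Z" if "a \<in> A" for a
    using comp_closed[OF h[OF that] f] .
  then have "(\<Sum>a\<in>A. f \<cdot> h a \<cdot> g) = (\<Sum>a\<in>A. f \<cdot> h a) \<cdot> g"
    by (rule comp_sum_left[OF g, symmetric])
  then show ?thesis
    using comp_sum_right[of A h X Y f Z] h f by simp
qed

text \<open>
  Composites are normalised by associating to the right; the next rule lets a relation
  \<open>g f = e\<close> act inside such a normal form.
\<close>

lemma comp_cancel:
  assumes "g \<cdot> f = e" "f \<in> Hom C X Y" "g \<in> Hom C Y Z" "x \<in> Hom C W X"
  shows "g \<cdot> (f \<cdot> x) = e \<cdot> x"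
  using comp_assoc[OF assms(4,2,3)] assms(1) by simp

lemma zero_object_iff: "zero_object C X \<longleftrightarrow> ident C X = 0"
proof
  assume 0: "ident C X = 0"
  have "f = 0" if "f \<in> Hom C X Y" for f Y
    using ident_right[OF that, unfolded 0] comp_zero_right[OF that] by (rule trans[OF sym])
  then have 1: "Hom C X Y = {0}" for Y
    using zero_Hom[of X Y] by blast
  have "f = 0" if "f \<in> Hom C Y X" for f Y
    using ident_left[OF that, unfolded 0] comp_zero_left[OF that] by (rule trans[OF sym])
  then have "Hom C Y X = {0}" for Y
    using zero_Hom[of Y X] by blast
  note 1 this
  then show "zero_object C X"
    unfolding zero_object_def by simp
next
  assume "zero_object C X"
  then have "Hom C X X = {0}"
    unfolding zero_object_def by simp
  then show "ident C X = 0"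
    using ident_closed[of X] by simp
qed

lemma is_isoI:
  "\<lbrakk>f \<in> Hom C X Y; g \<in> Hom C Y X; g \<cdot> f = ident C X; f \<cdot> g = ident C Y\<rbrakk> \<Longrightarrow> is_iso C X Y f"
  unfolding is_iso_def by blast

lemma is_isoE:
  assumes "is_iso C X Y f"
  obtains g where "f \<in> Hom C X Y" "g \<in> Hom C Y X" "g \<cdot> f = ident C X" "f \<cdot> g = ident C Y"
  using assms unfolding is_iso_def by blast

lemma is_iso_ident: "is_iso C X X (ident C X)"
  by (rule is_isoI[OF ident_closed ident_closed]) (simp_all add: ident_left[OF ident_closed])

lemma is_iso_comp:
  assumes "is_iso C X Y f" "is_iso C Y Z g"
  shows "is_iso C X Z (g \<cdot> f)"
proof -
  from assms obtain f' g' where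
    f: "f \<in> Hom C X Y" "f' \<in> Hom C Y X" "f' \<cdot> f = ident C X" "f \<cdot> f' = ident C Y" and
    g: "g \<in> Hom C Y Z" "g' \<in> Hom C Z Y" "g' \<cdot> g = ident C Y" "g \<cdot> g' = ident C Z"
    by (elim is_isoE)
  have "f' \<cdot> g' \<cdot> (g \<cdot> f) = ident C X"
    using f g comp_closed[OF f(1) g(1)] by (simp add: comp_assoc comp_cancel[OF g(3)] ident_left)
  moreover have "g \<cdot> f \<cdot> (f' \<cdot> g') = ident C Z"
    using f g comp_closed[OF g(2) f(2)] by (simp add: comp_assoc comp_cancel[OF f(4)] ident_left)
  ultimately show ?thesis
    using f g by (intro is_isoI[of _ _ _ "f' \<cdot> g'"]) (auto intro: comp_closed)
qed

lemma isomorphic_refl: "isomorphic C X X"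
  using is_iso_ident unfolding isomorphic_def by blast

lemma isomorphic_sym: "isomorphic C X Y \<Longrightarrow> isomorphic C Y X"
  unfolding isomorphic_def is_iso_def by blast

lemma isomorphic_trans: "isomorphic C X Y \<Longrightarrow> isomorphic C Y Z \<Longrightarrow> isomorphic C X Z"
  unfolding isomorphic_def using is_iso_comp by blast

lemma iso_class_eq_iff: "iso_class C X = iso_class C Y \<longleftrightarrow> isomorphic C X Y"
proof
  assume "iso_class C X = iso_class C Y"
  then show "isomorphic C X Y"
    using isomorphic_refl[of Y] unfolding iso_class_def by blast
next
  assume XY: "isomorphic C X Y"
  show "iso_class C X = iso_class C Y"
    unfolding iso_class_def
    using isomorphic_trans[OF XY] isomorphic_trans[OF isomorphic_sym[OF XY]] by blast
qed

end


section \<open>Direct sums\<close>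

definition biproduct ::
  "('k, 'o, 'm::ab_group_add) tricat \<Rightarrow> 'o \<Rightarrow> 'o \<Rightarrow> 'o \<Rightarrow> 'm \<Rightarrow> 'm \<Rightarrow> 'm \<Rightarrow> 'm \<Rightarrow> bool" where
  "biproduct C X A B i j p q \<longleftrightarrow>
     i \<in> Hom C A X \<and> j \<in> Hom C B X \<and> p \<in> Hom C X A \<and> q \<in> Hom C X B \<and>
     p \<cdot>\<^bsub>C\<^esub> i = ident C A \<and> q \<cdot>\<^bsub>C\<^esub> j = ident C B \<and> q \<cdot>\<^bsub>C\<^esub> i = 0 \<and> p \<cdot>\<^bsub>C\<^esub> j = 0 \<and>
     i \<cdot>\<^bsub>C\<^esub> p + j \<cdot>\<^bsub>C\<^esub> q = ident C X"

text \<open>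
  The relation \<open>direct_sum\<close> with its structure morphisms exposed: the exchange argument
  composes morphisms of two different decompositions.
\<close>

definition direct_sum_via ::
  "('k, 'o, 'm::ab_group_add) tricat \<Rightarrow> 'o \<Rightarrow> 'o list \<Rightarrow> (nat \<Rightarrow> 'm) \<Rightarrow> (nat \<Rightarrow> 'm) \<Rightarrow> bool" where
  "direct_sum_via C X Ys i p \<longleftrightarrow>
     (\<forall>a<length Ys. i a \<in> Hom C (Ys ! a) X \<and> p a \<in> Hom C X (Ys ! a)) \<and>
     (\<forall>a<length Ys. \<forall>b<length Ys. p b \<cdot>\<^bsub>C\<^esub> i a = (if a = b then ident C (Ys ! a) else 0)) \<and>
     (\<Sum>a<length Ys. i a \<cdot>\<^bsub>C\<^esub> p a) = ident C X"

lemma direct_sum_iff_via: "direct_sum C X Ys \<longleftrightarrow> (\<exists>i p. direct_sum_via C X Ys i p)"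
  unfolding direct_sum_def direct_sum_via_def ..

lemma sum_lessThan_add:
  fixes F :: "nat \<Rightarrow> 'a::comm_monoid_add"
  shows "(\<Sum>c<n + m. F c) = (\<Sum>c<n. F c) + (\<Sum>c<m. F (n + c))"
  by (induction m) (simp_all add: add.assoc)

context linear_category
begin

lemma biproductD:
  assumes "biproduct C X A B i j p q"
  shows "i \<in> Hom C A X" "j \<in> Hom C B X" "p \<in> Hom C X A" "q \<in> Hom C X B"
    "p \<cdot> i = ident C A" "q \<cdot> j = ident C B" "q \<cdot> i = 0" "p \<cdot> j = 0" "i \<cdot> p + j \<cdot> q = ident C X"
  using assms unfolding biproduct_def by blast+

lemma biproduct_commute: "biproduct C X A B i j p q \<Longrightarrow> biproduct C X B A j i q p"
  unfolding biproduct_def by (auto simp: add.commute)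

lemma direct_sum_pair_iff:
  "direct_sum C X [A, B] \<longleftrightarrow> (\<exists>i j p q. biproduct C X A B i j p q)"
proof
  assume "direct_sum C X [A, B]"
  then obtain i p where ip: "direct_sum_via C X [A, B] i p"
    unfolding direct_sum_iff_via by blast
  have "biproduct C X A B (i 0) (i 1) (p 0) (p 1)"
    using ip unfolding direct_sum_via_def biproduct_def
    by (simp add: less_Suc_eq all_conj_distrib)
  then show "\<exists>i j p q. biproduct C X A B i j p q" by blast
next
  assume "\<exists>i j p q. biproduct C X A B i j p q"
  then obtain i j p q where b: "biproduct C X A B i j p q" by blast
  have "direct_sum_via C X [A, B] (\<lambda>a. if a = 0 then i else j) (\<lambda>a. if a = 0 then p else q)"
    using b unfolding direct_sum_via_def biproduct_def
    by (simp add: less_Suc_eq all_conj_distrib)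
  then show "direct_sum C X [A, B]" unfolding direct_sum_iff_via by blast
qed

lemma direct_sum_Nil_iff: "direct_sum C X [] \<longleftrightarrow> zero_object C X"
  unfolding direct_sum_def zero_object_iff by auto

lemma direct_sum_viaD:
  assumes "direct_sum_via C X Ys i p"
  shows "a < length Ys \<Longrightarrow> i a \<in> Hom C (Ys ! a) X" "a < length Ys \<Longrightarrow> p a \<in> Hom C X (Ys ! a)"
    "a < length Ys \<Longrightarrow> b < length Ys \<Longrightarrow> p b \<cdot> i a = (if a = b then ident C (Ys ! a) else 0)"
    "(\<Sum>a<length Ys. i a \<cdot> p a) = ident C X"
  using assms unfolding direct_sum_via_def by blast+

lemma direct_sum_via_iso:
  assumes "direct_sum_via C X Ys i p" "is_iso C X X' f"
  shows "\<exists>i p. direct_sum_via C X' Ys i p"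
proof -
  note D = direct_sum_viaD[OF assms(1)]
  obtain g where f: "f \<in> Hom C X X'" "g \<in> Hom C X' X" "g \<cdot> f = ident C X" "f \<cdot> g = ident C X'"
    using assms(2) by (elim is_isoE)
  have "p b \<cdot> g \<cdot> (f \<cdot> i a) = p b \<cdot> i a" if "a < length Ys" "b < length Ys" for a b
    using that f D(1)[of a] D(2)[of b] comp_closed[OF D(1)[OF that(1)] f(1)]
    by (simp add: comp_assoc comp_cancel[OF f(3)] ident_left)
  moreover have "(\<Sum>a<length Ys. (f \<cdot> i a) \<cdot> (p a \<cdot> g)) = ident C X'"
  proof -
    have "(f \<cdot> i a) \<cdot> (p a \<cdot> g) = f \<cdot> (i a \<cdot> p a) \<cdot> g" if "a < length Ys" for a
      using f D(1)[OF that] D(2)[OF that] comp_closed[OF f(2) D(2)[OF that]]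
        comp_closed[OF D(2)[OF that] D(1)[OF that]]
      by (simp add: comp_assoc)
    then have "(\<Sum>a<length Ys. (f \<cdot> i a) \<cdot> (p a \<cdot> g)) = f \<cdot> (\<Sum>a<length Ys. i a \<cdot> p a) \<cdot> g"
      using sum_comp_both[of "{..<length Ys}" "\<lambda>a. i a \<cdot> p a" X X g X' f X'] f comp_closed[OF D(2) D(1)]
      by simp
    then show ?thesis using f D(4) ident_right by simp
  qed
  ultimately have "direct_sum_via C X' Ys (\<lambda>a. f \<cdot> i a) (\<lambda>a. p a \<cdot> g)"
    using D f unfolding direct_sum_via_def by (auto intro: comp_closed)
  then show ?thesis by blast
qed

lemma direct_sum_iso: "direct_sum C X Ys \<Longrightarrow> isomorphic C X X' \<Longrightarrow> direct_sum C X' Ys"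
  unfolding direct_sum_iff_via isomorphic_def using direct_sum_via_iso by blast

lemma direct_sum_singleton: "direct_sum C X [X]"
proof -
  have "direct_sum_via C X [X] (\<lambda>_. ident C X) (\<lambda>_. ident C X)"
    unfolding direct_sum_via_def by (simp add: ident_closed ident_left[OF ident_closed])
  then show ?thesis unfolding direct_sum_iff_via by blast
qed

text \<open>
  The inclusion \<open>j\<close> and the projection \<open>q\<close> of the complement pass through the tail
  \<open>As\<close>, whose summands occur both in \<open>X\<close> and in \<open>A'\<close>.
\<close>

lemma direct_sum_via_Cons:
  assumes X: "direct_sum_via C X (A # As) i p" and A': "direct_sum C A' As"
  shows "\<exists>j q. biproduct C X A A' (i 0) j (p 0) q"
proof -
  obtain k r where "direct_sum_via C A' As k r"
    using A' unfolding direct_sum_iff_via by blast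
  note D = direct_sum_viaD[OF X] and E = direct_sum_viaD[OF this]
  let ?n = "length As"
  have i0: "i 0 \<in> Hom C A X" "p 0 \<in> Hom C X A" "p 0 \<cdot> i 0 = ident C A"
    using D(1)[of 0] D(2)[of 0] D(3)[of 0 0] by simp_all
  have iS: "i (Suc a) \<in> Hom C (As ! a) X" "p (Suc a) \<in> Hom C X (As ! a)" if "a < ?n" for a
    using D(1)[of "Suc a"] D(2)[of "Suc a"] that by simp_all
  have pi: "p (Suc b) \<cdot> i (Suc a) = (if a = b then ident C (As ! a) else 0)"
    if "a < ?n" "b < ?n" for a b
    using D(3)[of "Suc a" "Suc b"] that by simp
  have pi0: "p 0 \<cdot> i (Suc a) = 0" "p (Suc a) \<cdot> i 0 = 0" if "a < ?n" for a
    using D(3)[of "Suc a" 0] D(3)[of 0 "Suc a"] that by simp_all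
  define j where "j = (\<Sum>a<?n. i (Suc a) \<cdot> r a)"
  define q where "q = (\<Sum>a<?n. k a \<cdot> p (Suc a))"
  have ir: "i (Suc a) \<cdot> r a \<in> Hom C A' X" and kp: "k a \<cdot> p (Suc a) \<in> Hom C X A'" if "a < ?n" for a
    using comp_closed[OF E(2)[OF that] iS(1)[OF that]] comp_closed[OF iS(2)[OF that] E(1)[OF that]]
    by simp_all
  have jH: "j \<in> Hom C A' X" and qH: "q \<in> Hom C X A'"
    unfolding j_def q_def using ir kp by (auto intro!: sum_Hom)
  have pj: "p (Suc a) \<cdot> j = r a" if a: "a < ?n" for a
  proof -
    have "p (Suc a) \<cdot> j = (\<Sum>b<?n. p (Suc a) \<cdot> (i (Suc b) \<cdot> r b))"
      unfolding j_def by (rule comp_sum_right[OF ir iS(2)[OF a]]) simp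
    also have "\<dots> = (\<Sum>b<?n. if b = a then r b else 0)"
    proof (rule sum.cong)
      fix b assume "b \<in> {..<?n}"
      then have b: "b < ?n" by simp
      show "p (Suc a) \<cdot> (i (Suc b) \<cdot> r b) = (if b = a then r b else 0)"
        using comp_cancel[OF pi[OF b a] iS(1)[OF b] iS(2)[OF a] E(2)[OF b]]
          ident_left[OF E(2)[OF b]] comp_zero_left[OF E(2)[OF b]] by (cases "b = a") simp_all
    qed simp
    finally show ?thesis using a by simp
  qed
  have p0j: "p 0 \<cdot> j = 0"
  proof -
    have "p 0 \<cdot> j = (\<Sum>b<?n. p 0 \<cdot> (i (Suc b) \<cdot> r b))"
      unfolding j_def by (rule comp_sum_right[OF ir i0(2)]) simp
    also have "\<dots> = 0"
    proof (rule sum.neutral, rule ballI)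
      fix b assume "b \<in> {..<?n}"
      then have b: "b < ?n" by simp
      show "p 0 \<cdot> (i (Suc b) \<cdot> r b) = 0"
        using comp_cancel[OF pi0(1)[OF b] iS(1)[OF b] i0(2) E(2)[OF b]] comp_zero_left[OF E(2)[OF b]]
        by simp
    qed
    finally show ?thesis .
  qed
  have qi0: "q \<cdot> i 0 = 0"
  proof -
    have "q \<cdot> i 0 = (\<Sum>b<?n. k b \<cdot> p (Suc b) \<cdot> i 0)"
      unfolding q_def by (rule comp_sum_left[OF i0(1) kp]) simp
    also have "\<dots> = 0"
    proof (rule sum.neutral, rule ballI)
      fix b assume "b \<in> {..<?n}"
      then have b: "b < ?n" by simp
      show "k b \<cdot> p (Suc b) \<cdot> i 0 = 0"
        using comp_assoc[OF i0(1) iS(2)[OF b] E(1)[OF b]] pi0(2)[OF b] comp_zero_right[OF E(1)[OF b]]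
        by simp
    qed
    finally show ?thesis .
  qed
  have qj: "q \<cdot> j = ident C A'"
  proof -
    have "q \<cdot> j = (\<Sum>b<?n. k b \<cdot> p (Suc b) \<cdot> j)"
      unfolding q_def by (rule comp_sum_left[OF jH kp]) simp
    also have "\<dots> = (\<Sum>b<?n. k b \<cdot> r b)"
    proof (rule sum.cong)
      fix b assume "b \<in> {..<?n}"
      then have b: "b < ?n" by simp
      show "k b \<cdot> p (Suc b) \<cdot> j = k b \<cdot> r b"
        using comp_assoc[OF jH iS(2)[OF b] E(1)[OF b]] pj[OF b] by simp
    qed simp
    finally show ?thesis using E(4) by simp
  qed
  have rq: "r a \<cdot> q = p (Suc a)" if a: "a < ?n" for a
  proof -
    have "r a \<cdot> q = (\<Sum>b<?n. r a \<cdot> (k b \<cdot> p (Suc b)))"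
      unfolding q_def by (rule comp_sum_right[OF kp E(2)[OF a]]) simp
    also have "\<dots> = (\<Sum>b<?n. if b = a then p (Suc b) else 0)"
    proof (rule sum.cong)
      fix b assume "b \<in> {..<?n}"
      then have b: "b < ?n" by simp
      show "r a \<cdot> (k b \<cdot> p (Suc b)) = (if b = a then p (Suc b) else 0)"
        using comp_cancel[OF E(3)[OF b a] E(1)[OF b] E(2)[OF a] iS(2)[OF b]]
          ident_left[OF iS(2)[OF b]] comp_zero_left[OF iS(2)[OF b]] by (cases "b = a") simp_all
    qed simp
    finally show ?thesis using a by simp
  qed
  have "j \<cdot> q = (\<Sum>b<?n. i (Suc b) \<cdot> p (Suc b))"
  proof -
    have "j \<cdot> q = (\<Sum>b<?n. i (Suc b) \<cdot> r b \<cdot> q)"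
      unfolding j_def by (rule comp_sum_left[OF qH ir]) simp
    also have "\<dots> = (\<Sum>b<?n. i (Suc b) \<cdot> p (Suc b))"
    proof (rule sum.cong)
      fix b assume "b \<in> {..<?n}"
      then have b: "b < ?n" by simp
      show "i (Suc b) \<cdot> r b \<cdot> q = i (Suc b) \<cdot> p (Suc b)"
        using comp_assoc[OF qH E(2)[OF b] iS(1)[OF b]] rq[OF b] by simp
    qed simp
    finally show ?thesis .
  qed
  then have "i 0 \<cdot> p 0 + j \<cdot> q = ident C X"
    using D(4) by (simp add: sum.lessThan_Suc_shift del: sum.lessThan_Suc)
  then have "biproduct C X A A' (i 0) j (p 0) q"
    unfolding biproduct_def using i0 jH qH p0j qi0 qj by simp
  then show ?thesis by blast
qed

lemma direct_sum_Cons: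
  assumes "direct_sum C X (A # As)" "direct_sum C A' As"
  shows "direct_sum C X [A, A']"
  using assms direct_sum_via_Cons unfolding direct_sum_pair_iff
  by (metis direct_sum_iff_via)

lemma direct_sum_append:
  assumes X: "direct_sum C X [A, B]" and A: "direct_sum C A As" and B: "direct_sum C B Bs"
  shows "direct_sum C X (As @ Bs)"
proof -
  obtain i j p q where "biproduct C X A B i j p q"
    using X unfolding direct_sum_pair_iff by blast
  note b = biproductD[OF this]
  obtain k r where "direct_sum_via C A As k r" using A unfolding direct_sum_iff_via by blast
  note D = direct_sum_viaD[OF this]
  obtain l s where "direct_sum_via C B Bs l s" using B unfolding direct_sum_iff_via by blast
  note E = direct_sum_viaD[OF this]
  let ?n = "length As" and ?m = "length Bs"
  define I where "I c = (if c < ?n then i \<cdot> k c else j \<cdot> l (c - ?n))" for c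
  define P where "P c = (if c < ?n then r c \<cdot> p else s (c - ?n) \<cdot> q)" for c
  have IH: "I c \<in> Hom C ((As @ Bs) ! c) X" and PH: "P c \<in> Hom C X ((As @ Bs) ! c)"
    if "c < ?n + ?m" for c
    using that comp_closed[OF D(1)[of c] b(1)] comp_closed[OF E(1)[of "c - ?n"] b(2)]
      comp_closed[OF b(3) D(2)[of c]] comp_closed[OF b(4) E(2)[of "c - ?n"]]
    by (auto simp: I_def P_def nth_append)
  have reassoc: "v \<cdot> t \<cdot> (z \<cdot> u) = v \<cdot> ((t \<cdot> z) \<cdot> u)"
    if "u \<in> Hom C U V" "z \<in> Hom C V X'" "t \<in> Hom C X' W" "v \<in> Hom C W Y" for u z t v U V W X' Y
    using that comp_closed[OF that(1,2)] by (simp add: comp_assoc)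
  have reassoc': "v \<cdot> t \<cdot> (z \<cdot> u) = v \<cdot> (t \<cdot> z) \<cdot> u"
    if "u \<in> Hom C U V" "z \<in> Hom C V X'" "t \<in> Hom C X' W" "v \<in> Hom C W Y" for u z t v U V W X' Y
    using that reassoc[OF that] comp_assoc[OF that(1) comp_closed[OF that(2,3)] that(4)] by simp
  have PI: "P d \<cdot> I c = (if c = d then ident C ((As @ Bs) ! c) else 0)"
    if c: "c < ?n + ?m" and d: "d < ?n + ?m" for c d
  proof -
    consider "c < ?n" "d < ?n" | "c < ?n" "\<not> d < ?n" | "\<not> c < ?n" "d < ?n" | "\<not> c < ?n" "\<not> d < ?n"
      by blast
    then show ?thesis
    proof cases
      case 1
      then show ?thesis
        using reassoc[OF D(1)[of c] b(1,3) D(2)[of d]] D(3)[of c d] b(5) ident_left[OF D(1)[of c]]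
        by (simp add: I_def P_def nth_append)
    next
      case 2
      then have d': "d - ?n < ?m" using d by simp
      show ?thesis
        using 2 reassoc[OF D(1)[of c] b(1,4) E(2)[OF d']] b(7) comp_zero_left[OF D(1)[of c]]
          comp_zero_right[OF E(2)[OF d']]
        by (auto simp add: I_def P_def nth_append)
    next
      case 3
      then have c': "c - ?n < ?m" using c by simp
      show ?thesis
        using 3 reassoc[OF E(1)[OF c'] b(2,3) D(2)[of d]] b(8) comp_zero_left[OF E(1)[OF c']]
          comp_zero_right[OF D(2)[of d]]
        by (auto simp add: I_def P_def nth_append)
    next
      case 4
      then have c': "c - ?n < ?m" and d': "d - ?n < ?m" using c d by simp_all
      have "c = d \<longleftrightarrow> c - ?n = d - ?n" using 4 by auto
      then show ?thesis
        using 4 reassoc[OF E(1)[OF c'] b(2,4) E(2)[OF d']] E(3)[OF c' d'] b(6) ident_left[OF E(1)[OF c']]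
        by (simp add: I_def P_def nth_append)
    qed
  qed
  have 1: "(\<Sum>c<?n. I c \<cdot> P c) = i \<cdot> p"
  proof -
    have "(\<Sum>c<?n. I c \<cdot> P c) = (\<Sum>c<?n. i \<cdot> (k c \<cdot> r c) \<cdot> p)"
      using reassoc'[OF b(3) D(2) D(1) b(1)]
      by (intro sum.cong refl) (simp add: I_def P_def)
    also have "\<dots> = i \<cdot> (\<Sum>c<?n. k c \<cdot> r c) \<cdot> p"
      using sum_comp_both[of "{..<?n}" "\<lambda>c. k c \<cdot> r c" A A p X i X] b comp_closed[OF D(2) D(1)]
      by simp
    finally show ?thesis using D(4) b ident_right by simp
  qed
  have 2: "(\<Sum>c<?m. I (?n + c) \<cdot> P (?n + c)) = j \<cdot> q"
  proof -
    have "(\<Sum>c<?m. I (?n + c) \<cdot> P (?n + c)) = (\<Sum>c<?m. j \<cdot> (l c \<cdot> s c) \<cdot> q)"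
      using reassoc'[OF b(4) E(2) E(1) b(2)]
      by (intro sum.cong refl) (simp add: I_def P_def)
    also have "\<dots> = j \<cdot> (\<Sum>c<?m. l c \<cdot> s c) \<cdot> q"
      using sum_comp_both[of "{..<?m}" "\<lambda>c. l c \<cdot> s c" B B q X j X] b comp_closed[OF E(2) E(1)]
      by simp
    finally show ?thesis using E(4) b ident_right by simp
  qed
  have "direct_sum_via C X (As @ Bs) I P"
    unfolding direct_sum_via_def using IH PH PI 1 2 b(9) by (simp add: sum_lessThan_add)
  then show ?thesis unfolding direct_sum_iff_via by blast
qed

end


section \<open>The Krull-Remak-Schmidt theorem\<close>

context linear_category
begin

lemma local_sum_iso:
  assumes A: "local_endomorphism_ring C A"
    and "finite S" "\<And>s. s \<in> S \<Longrightarrow> e s \<in> Hom C A A" "is_iso C A A (sum e S)"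
  shows "\<exists>s\<in>S. is_iso C A A (e s)"
  using assms(2-)
proof (induction S rule: finite_induct)
  case empty
  then obtain g where "g \<in> Hom C A A" "g \<cdot> 0 = ident C A" by (auto elim: is_isoE)
  then show ?case using A unfolding local_endomorphism_ring_def by simp
next
  case (insert s S)
  then have "is_iso C A A (e s + sum e S)" by simp
  moreover have "e s \<in> Hom C A A" "sum e S \<in> Hom C A A"
    using insert.prems by (auto intro: sum_Hom)
  ultimately have "is_iso C A A (e s) \<or> is_iso C A A (sum e S)"
    using A unfolding local_endomorphism_ring_def by blast
  then show ?case using insert by blast
qed

lemma idempotent_iso_eq_ident:
  assumes "e \<cdot> e = e" "is_iso C B B e"
  shows "e = ident C B"
proof -
  obtain g where "e \<in> Hom C B B" "g \<in> Hom C B B" "g \<cdot> e = ident C B"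
    using assms(2) by (elim is_isoE)
  then show ?thesis
    using comp_cancel[of g e "ident C B" B B B e B] assms(1) ident_left by simp
qed

text \<open>
  With \<open>w\<close> inverse to \<open>v u\<close>, the endomorphism \<open>e = u w v\<close> of \<open>B\<close> is idempotent,
  hence \<open>1\<close> or \<open>0\<close> as \<open>B\<close> is local. It is not \<open>0\<close>, because \<open>e u = u\<close>.
\<close>

lemma local_factor_iso:
  assumes A: "local_endomorphism_ring C A" and B: "local_endomorphism_ring C B"
    and u: "u \<in> Hom C A B" and v: "v \<in> Hom C B A" and vu: "is_iso C A A (v \<cdot> u)"
  shows "is_iso C A B u"
proof -
  obtain w where w: "w \<in> Hom C A A" "w \<cdot> (v \<cdot> u) = ident C A" using vu by (elim is_isoE)
  have wv: "w \<cdot> v \<in> Hom C B A" "w \<cdot> v \<cdot> u = ident C A"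
    using w v u by (simp_all add: comp_closed comp_assoc[OF u v w(1)])
  define e where "e = u \<cdot> (w \<cdot> v)"
  have e: "e \<in> Hom C B B" unfolding e_def using wv u by (auto intro: comp_closed)
  have eu: "e \<cdot> u = u"
    unfolding e_def using comp_assoc[OF u wv(1) u] wv(2) ident_right[OF u] by simp
  have ee: "e \<cdot> e = e"
    using comp_assoc[OF wv(1) u e] eu unfolding e_def by simp
  have d: "ident C B - e \<in> Hom C B B" by (rule diff_Hom[OF ident_closed e])
  have dd: "(ident C B - e) \<cdot> (ident C B - e) = ident C B - e"
    using comp_diff_left[OF d ident_closed e] comp_diff_right[OF ident_closed e e] ee
      ident_left[OF d] ident_right[OF e] by simp
  have "is_iso C B B (e + (ident C B - e))" using is_iso_ident by simp
  then have "is_iso C B B e \<or> is_iso C B B (ident C B - e)"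
    using B e d unfolding local_endomorphism_ring_def by blast
  then show ?thesis
  proof
    assume "is_iso C B B e"
    then have "u \<cdot> (w \<cdot> v) = ident C B"
      using idempotent_iso_eq_ident ee unfolding e_def by blast
    then show ?thesis using wv u by (auto intro: is_isoI)
  next
    assume "is_iso C B B (ident C B - e)"
    then have "ident C B - e = ident C B" using idempotent_iso_eq_ident dd by blast
    then have "u = 0" using eu comp_zero_left[OF u] by simp
    then have "ident C A = 0" using w v comp_zero_right[OF v] comp_zero_right[OF w(1)] by simp
    then show ?thesis using A unfolding local_endomorphism_ring_def by simp
  qed
qed

text \<open>
  As \<open>q i\<close> is invertible, \<open>B'\<close> is a complement not only of \<open>B\<close> but also of \<open>A\<close>, and
  any two complements of \<open>A\<close> are isomorphic.
\<close>

lemma biproduct_cancel: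
  assumes A: "biproduct C X A A' i i' p p'" and B: "biproduct C X B B' j j' q q'"
    and qi: "is_iso C A B (q \<cdot> i)"
  shows "isomorphic C A' B'"
proof -
  note a = biproductD[OF A] and b = biproductD[OF B]
  obtain \<theta> where \<theta>: "\<theta> \<in> Hom C B A" "\<theta> \<cdot> (q \<cdot> i) = ident C A" "q \<cdot> i \<cdot> \<theta> = ident C B"
    using qi by (elim is_isoE)
  have \<theta>q: "\<theta> \<cdot> q \<in> Hom C X A" by (rule comp_closed[OF b(3) \<theta>(1)])
  \<comment> \<open>the projection with image \<open>B'\<close> and kernel \<open>A\<close>\<close>
  define t where "t = ident C X - i \<cdot> (\<theta> \<cdot> q)"
  have s: "i \<cdot> (\<theta> \<cdot> q) \<in> Hom C X X" by (rule comp_closed[OF \<theta>q a(1)])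
  have t: "t \<in> Hom C X X" unfolding t_def by (rule diff_Hom[OF ident_closed s])
  have ti: "t \<cdot> i = 0"
    unfolding t_def using comp_diff_left[OF a(1) ident_closed s] comp_assoc[OF a(1) \<theta>q a(1)]
      comp_assoc[OF a(1) b(3) \<theta>(1)] \<theta>(2) ident_left[OF a(1)] ident_right[OF a(1)] by simp
  have tj': "t \<cdot> j' = j'"
    unfolding t_def using comp_diff_left[OF b(2) ident_closed s] comp_assoc[OF b(2) \<theta>q a(1)]
      comp_assoc[OF b(2) b(3) \<theta>(1)] b(8) comp_zero_right[OF \<theta>(1)] comp_zero_right[OF a(1)]
      ident_left[OF b(2)] by simp
  have qt: "q \<cdot> t = 0"
    unfolding t_def using comp_diff_right[OF ident_closed s b(3)] comp_assoc[OF \<theta>q a(1) b(3)]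
      comp_assoc[OF b(3) \<theta>(1) comp_closed[OF a(1) b(3)]] \<theta>(3) ident_left[OF b(3)] ident_right[OF b(3)]
    by simp
  have p't: "p' \<cdot> t = p'"
    unfolding t_def using comp_diff_right[OF ident_closed s a(4)] comp_assoc[OF \<theta>q a(1) a(4)] a(7)
      comp_zero_left[OF \<theta>q] ident_right[OF a(4)] by simp
  have ti': "t \<cdot> i' \<in> Hom C A' X" by (rule comp_closed[OF a(2) t])
  have u: "q' \<cdot> (t \<cdot> i') \<in> Hom C A' B'" by (rule comp_closed[OF ti' b(4)])
  have v: "p' \<cdot> j' \<in> Hom C B' A'" by (rule comp_closed[OF b(2) a(4)])
  have qti': "q \<cdot> (t \<cdot> i') = 0"
    using comp_cancel[OF qt t b(3) a(2)] comp_zero_left[OF a(2)] by simp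
  have "p' \<cdot> j' \<cdot> (q' \<cdot> (t \<cdot> i')) = p' \<cdot> (j' \<cdot> (q' \<cdot> (t \<cdot> i')))"
    by (rule comp_assoc[OF u b(2) a(4)])
  also have "j' \<cdot> (q' \<cdot> (t \<cdot> i')) = t \<cdot> i'"
    using comp_add_left[OF ti' comp_closed[OF b(3) b(1)] comp_closed[OF b(4) b(2)]] b(9)
      comp_assoc[OF ti' b(3) b(1)] comp_assoc[OF ti' b(4) b(2)] qti' comp_zero_right[OF b(1)]
      ident_left[OF ti'] by simp
  also have "p' \<cdot> (t \<cdot> i') = ident C A'"
    using comp_cancel[OF p't t a(4) a(2)] a(6) by simp
  finally have vu: "p' \<cdot> j' \<cdot> (q' \<cdot> (t \<cdot> i')) = ident C A'" .
  have pj': "p \<cdot> j' \<in> Hom C B' A" by (rule comp_closed[OF b(2) a(3)])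
  have ipj': "i \<cdot> (p \<cdot> j') \<in> Hom C B' X" by (rule comp_closed[OF pj' a(1)])
  have "q' \<cdot> (t \<cdot> i') \<cdot> (p' \<cdot> j') = q' \<cdot> (t \<cdot> (i' \<cdot> (p' \<cdot> j')))"
    using comp_assoc[OF v ti' b(4)] comp_assoc[OF v a(2) t] by simp
  also have "i' \<cdot> (p' \<cdot> j') = j' - i \<cdot> (p \<cdot> j')"
    using comp_add_left[OF b(2) comp_closed[OF a(3) a(1)] comp_closed[OF a(4) a(2)]] a(9)
      comp_assoc[OF b(2) a(3) a(1)] comp_assoc[OF b(2) a(4) a(2)] ident_left[OF b(2)]
    by (simp add: algebra_simps)
  also have "t \<cdot> (j' - i \<cdot> (p \<cdot> j')) = j'"
    using comp_diff_right[OF b(2) ipj' t] comp_cancel[OF ti a(1) t pj'] comp_zero_left[OF pj'] tj'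
    by simp
  finally have uv: "q' \<cdot> (t \<cdot> i') \<cdot> (p' \<cdot> j') = ident C B'" using b(6) by simp
  show ?thesis unfolding isomorphic_def using is_isoI[OF u v vu uv] by blast
qed

text \<open>
  Brings the summand found by the exchange argument to the head of the list, where
  \<open>direct_sum_via_Cons\<close> can split it off.
\<close>

lemma direct_sum_via_transpose:
  assumes D: "direct_sum_via C X Ys i p" and b: "b < length Ys"
  shows "\<exists>Zs. mset (Ys ! b # Zs) = mset Ys \<and>
    direct_sum_via C X (Ys ! b # Zs) (i \<circ> Transposition.transpose 0 b) (p \<circ> Transposition.transpose 0 b)"
proof -
  let ?t = "Transposition.transpose 0 b" and ?n = "length Ys"
  define Ws where "Ws = Ys[0 := Ys ! b, b := Ys ! 0]"
  have len: "length Ws = ?n" unfolding Ws_def by simp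
  have tr: "?t a < ?n" if "a < ?n" for a using that b by (auto simp: Transposition.transpose_def)
  have nth: "Ws ! a = Ys ! ?t a" if "a < ?n" for a
    using that b unfolding Ws_def by (auto simp: Transposition.transpose_def nth_list_update)
  have inj: "?t a = ?t c \<longleftrightarrow> a = c" for a c
    by (metis transpose_involutory)
  have bij: "bij_betw ?t {..<?n} {..<?n}"
    by (rule bij_betwI[of _ _ _ ?t]) (auto simp: tr)
  have "(\<Sum>a<?n. i (?t a) \<cdot> p (?t a)) = ident C X"
    using sum.reindex_bij_betw[OF bij, of "\<lambda>a. i a \<cdot> p a"] direct_sum_viaD(4)[OF D] by simp
  then have "direct_sum_via C X Ws (i \<circ> ?t) (p \<circ> ?t)"
    using direct_sum_viaD(1-3)[OF D] unfolding direct_sum_via_def len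
    by (simp add: nth tr inj)
  moreover have "Ws = Ys ! b # tl Ws"
  proof -
    have "Ws \<noteq> []" using len b by auto
    moreover have "0 < ?n" by (rule le_less_trans[OF le0 b])
    then have "hd Ws = Ys ! b"
      using nth hd_conv_nth[OF \<open>Ws \<noteq> []\<close>] by simp
    ultimately show ?thesis by (metis list.collapse)
  qed
  moreover have "mset Ws = mset Ys"
    unfolding Ws_def using mset_swap[OF b le_less_trans[OF le0 b]] .
  ultimately show ?thesis by metis
qed

text \<open>
  An isomorphism \<open>f\<close> with inverse \<open>g\<close> transports endomorphisms by \<open>e \<mapsto> g e f\<close>.
\<close>

lemma isomorphic_local:
  assumes "isomorphic C X Y" "local_endomorphism_ring C X"
  shows "local_endomorphism_ring C Y"
proof -
  obtain f g where f: "f \<in> Hom C X Y" "g \<in> Hom C Y X" "g \<cdot> f = ident C X" "f \<cdot> g = ident C Y"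
    using assms(1) unfolding isomorphic_def is_iso_def by blast
  have fi: "is_iso C X Y f" "is_iso C Y X g" using f by (auto intro: is_isoI)
  have conj: "e = f \<cdot> (g \<cdot> e \<cdot> f) \<cdot> g" if "e \<in> Hom C Y Y" for e
  proof -
    have 1: "g \<cdot> e \<in> Hom C Y X" by (rule comp_closed[OF that f(2)])
    have "f \<cdot> (g \<cdot> e \<cdot> f) \<cdot> g = f \<cdot> (g \<cdot> e \<cdot> f \<cdot> g)"
      by (rule comp_assoc[OF f(2) comp_closed[OF f(1) 1] f(1)])
    also have "g \<cdot> e \<cdot> f \<cdot> g = g \<cdot> e"
      using comp_assoc[OF f(2) f(1) 1] f(4) ident_right[OF 1] by simp
    also have "f \<cdot> (g \<cdot> e) = e"
      using comp_cancel[OF f(4) f(2,1) that] ident_left[OF that] by simp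
    finally show ?thesis ..
  qed
  have iso: "is_iso C Y Y e" if "e \<in> Hom C Y Y" "is_iso C X X (g \<cdot> e \<cdot> f)" for e
    using is_iso_comp[OF fi(2) is_iso_comp[OF that(2) fi(1)]] conj[OF that(1)] by simp
  have "ident C Y \<noteq> 0"
  proof
    assume "ident C Y = 0"
    then have "f = 0" using ident_left[OF f(1)] comp_zero_left[OF f(1)] by simp
    then have "ident C X = 0" using f(3) comp_zero_right[OF f(2)] by simp
    then show False using assms(2) unfolding local_endomorphism_ring_def by simp
  qed
  moreover have "is_iso C Y Y d \<or> is_iso C Y Y e"
    if d: "d \<in> Hom C Y Y" and e: "e \<in> Hom C Y Y" and "is_iso C Y Y (d + e)" for d e
  proof -
    have "is_iso C X X (g \<cdot> (d + e) \<cdot> f)"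
      by (rule is_iso_comp[OF fi(1) is_iso_comp[OF that(3) fi(2)]])
    then have "is_iso C X X (g \<cdot> d \<cdot> f + g \<cdot> e \<cdot> f)"
      using comp_add_right[OF d e f(2)] comp_add_left[OF f(1) comp_closed[OF d f(2)] comp_closed[OF e f(2)]]
      by simp
    moreover have "g \<cdot> d \<cdot> f \<in> Hom C X X" "g \<cdot> e \<cdot> f \<in> Hom C X X"
      using comp_closed[OF f(1) comp_closed[OF d f(2)]] comp_closed[OF f(1) comp_closed[OF e f(2)]] .
    ultimately have "is_iso C X X (g \<cdot> d \<cdot> f) \<or> is_iso C X X (g \<cdot> e \<cdot> f)"
      using assms(2) unfolding local_endomorphism_ring_def by blast
    then show ?thesis using iso d e by blast
  qed
  ultimately show ?thesis unfolding local_endomorphism_ring_def by blast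
qed

text \<open>
  A decomposition writes the identity as \<open>i p + j q\<close>; if the summand \<open>i p\<close> is invertible,
  then \<open>q i = 0\<close> forces \<open>q = 0\<close>.
\<close>

lemma local_imp_indecomposable:
  assumes X: "local_endomorphism_ring C X"
  shows "indecomposable C X"
  unfolding indecomposable_def
proof (intro conjI allI impI)
  show "\<not> zero_object C X"
    using X unfolding zero_object_iff local_endomorphism_ring_def by simp
next
  fix A B assume "direct_sum C X [A, B]"
  then obtain i j p q where bip: "biproduct C X A B i j p q"
    unfolding direct_sum_pair_iff by blast
  have zero: "zero_object C B'" if bi: "biproduct C X A' B' i j p q" and iso: "is_iso C X X (i \<cdot> p)"
    for A' B' i j p q
  proof -
    note b = biproductD[OF bi]
    obtain g where g: "g \<in> Hom C X X" "i \<cdot> p \<cdot> g = ident C X"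
      using iso by (elim is_isoE)
    have "q \<cdot> (i \<cdot> p \<cdot> g) = 0"
      using comp_assoc[OF g(1) b(3) b(1)] comp_cancel[OF b(7) b(1) b(4) comp_closed[OF g(1) b(3)]]
        comp_zero_left[OF comp_closed[OF g(1) b(3)]] by simp
    then have "q = 0" using g ident_right[OF b(4)] by simp
    then show ?thesis unfolding zero_object_iff using b(6) comp_zero_left[OF b(2)] by simp
  qed
  have "is_iso C X X (i \<cdot> p) \<or> is_iso C X X (j \<cdot> q)"
    using X is_iso_ident[of X] biproductD(9)[OF bip]
      comp_closed[OF biproductD(3)[OF bip] biproductD(1)[OF bip]]
      comp_closed[OF biproductD(4)[OF bip] biproductD(2)[OF bip]]
    unfolding local_endomorphism_ring_def by metis
  then show "zero_object C A \<or> zero_object C B"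
    using zero bip biproduct_commute by blast
qed

lemma zero_object_iso: "zero_object C X \<Longrightarrow> isomorphic C X Y \<Longrightarrow> zero_object C Y"
  using direct_sum_iso direct_sum_Nil_iff by blast

lemma direct_sum_zero_object:
  assumes "direct_sum C X [A, B]" "zero_object C B"
  shows "isomorphic C X A"
proof -
  obtain i j p q where "biproduct C X A B i j p q"
    using assms(1) unfolding direct_sum_pair_iff by blast
  note b = biproductD[OF this]
  have "q = 0" using b(4) assms(2) unfolding zero_object_def by blast
  then have "i \<cdot> p = ident C X" using b(9) comp_zero_right[OF b(2)] by simp
  then show ?thesis unfolding isomorphic_def using is_isoI[OF b(3,1)] b(5) by blast
qed

lemma direct_sum_pair_commute: "direct_sum C X [A, B] \<Longrightarrow> direct_sum C X [B, A]"
  unfolding direct_sum_pair_iff using biproduct_commute by blast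

end


locale krull_schmidt_category = linear_category +
  assumes direct_sum_exists: "\<exists>X. direct_sum C X Ys"
    and krull_schmidt: "krull_remak_schmidt C"
begin

text \<open>
  An indecomposable object is isomorphic to the first member of any decomposition of it into
  objects with local endomorphism rings.
\<close>

lemma indecomposable_iff_local: "indecomposable C X \<longleftrightarrow> local_endomorphism_ring C X"
proof
  assume X: "indecomposable C X"
  obtain Ys where Ys: "direct_sum C X Ys" "\<forall>Y\<in>set Ys. local_endomorphism_ring C Y"
    using krull_schmidt unfolding krull_remak_schmidt_def by blast
  show "local_endomorphism_ring C X"
  proof (cases Ys)
    case Nil
    then show ?thesis using Ys X unfolding indecomposable_def by (simp add: direct_sum_Nil_iff)
  next
    case (Cons Y Zs)
    obtain Z where "direct_sum C Z Zs" using direct_sum_exists by blast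
    then have X2: "direct_sum C X [Y, Z]" using Ys Cons direct_sum_Cons by blast
    have Y: "local_endomorphism_ring C Y" using Ys Cons by simp
    then have "\<not> zero_object C Y" unfolding zero_object_iff local_endomorphism_ring_def by simp
    then have "zero_object C Z" using X X2 unfolding indecomposable_def by blast
    then have "isomorphic C Y X" using direct_sum_zero_object[OF X2] isomorphic_sym by blast
    then show ?thesis using Y isomorphic_local by blast
  qed
qed (rule local_imp_indecomposable)

text \<open>
  The identity of the first summand \<open>A\<close> is the sum of the endomorphisms that pass through the
  summands \<open>Z\<close> of the other decomposition. One of them is invertible since \<open>A\<close> is local, so
  \<open>A \<cong> Z\<close>; the complements of \<open>A\<close> and \<open>Z\<close> are isomorphic, and induction applies to them.
\<close>

theorem decomposition_unique:
  assumes "direct_sum C X Ys" "direct_sum C X' Zs" "isomorphic C X X'"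
    and "\<forall>Y\<in>set Ys. indecomposable C Y" "\<forall>Z\<in>set Zs. indecomposable C Z"
  shows "image_mset (iso_class C) (mset Ys) = image_mset (iso_class C) (mset Zs)"
  using assms
proof (induction Ys arbitrary: X X' Zs)
  case Nil
  have 0: "zero_object C X'" using Nil zero_object_iso direct_sum_Nil_iff by blast
  show ?case
  proof (cases Zs)
    case (Cons Z Zs')
    obtain W where W: "direct_sum C W Zs'" using direct_sum_exists by blast
    obtain i j p q where "biproduct C X' Z W i j p q"
      using Nil(2) Cons W direct_sum_Cons direct_sum_pair_iff by metis
    note b = biproductD[OF this]
    have "p = 0" using b(3) 0 unfolding zero_object_def by blast
    then have "zero_object C Z" unfolding zero_object_iff using b(5) comp_zero_left[OF b(1)] by simp
    then show ?thesis using Nil(5) Cons unfolding indecomposable_def by simp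
  qed simp
next
  case (Cons A As)
  have A: "local_endomorphism_ring C A" using Cons.prems indecomposable_iff_local by simp
  have loc: "local_endomorphism_ring C (Zs ! b)" if "b < length Zs" for b
    using Cons.prems that indecomposable_iff_local by simp
  obtain i p where ip: "direct_sum_via C X (A # As) i p"
    using Cons.prems unfolding direct_sum_iff_via by blast
  obtain A' where A': "direct_sum C A' As" using direct_sum_exists by blast
  obtain i' p' where a: "biproduct C X A A' (i 0) i' (p 0) p'"
    using direct_sum_via_Cons[OF ip A'] by blast
  note aD = biproductD[OF a]
  obtain j q where jq: "direct_sum_via C X Zs j q"
    using direct_sum_iso[OF Cons.prems(2) isomorphic_sym[OF Cons.prems(3)]]
    unfolding direct_sum_iff_via by blast
  note D = direct_sum_viaD[OF jq]
  let ?e = "\<lambda>b. p 0 \<cdot> (j b \<cdot> q b) \<cdot> i 0"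
  have "(\<Sum>b<length Zs. ?e b) = p 0 \<cdot> (\<Sum>b<length Zs. j b \<cdot> q b) \<cdot> i 0"
    using sum_comp_both[of "{..<length Zs}" "\<lambda>b. j b \<cdot> q b" X X "i 0" A "p 0" A]
      comp_closed[OF D(2) D(1)] aD(1,3) by simp
  also have "\<dots> = ident C A" using D(4) aD(5) ident_right[OF aD(3)] by simp
  finally have "is_iso C A A (\<Sum>b<length Zs. ?e b)" using is_iso_ident by simp
  moreover have "?e b \<in> Hom C A A" if "b < length Zs" for b
    by (rule comp_closed[OF aD(1) comp_closed[OF comp_closed[OF D(2)[OF that] D(1)[OF that]] aD(3)]])
  ultimately obtain b where b: "b < length Zs" "is_iso C A A (?e b)"
    using local_sum_iso[OF A, of "{..<length Zs}" ?e] by auto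
  have qi: "q b \<cdot> i 0 \<in> Hom C A (Zs ! b)" and pj: "p 0 \<cdot> j b \<in> Hom C (Zs ! b) A"
    using comp_closed[OF aD(1) D(2)[OF b(1)]] comp_closed[OF D(1)[OF b(1)] aD(3)] by simp_all
  have "?e b = p 0 \<cdot> j b \<cdot> (q b \<cdot> i 0)"
    using comp_assoc[OF D(2)[OF b(1)] D(1)[OF b(1)] aD(3)] comp_assoc[OF aD(1) D(2)[OF b(1)] pj] by simp
  then have qi_iso: "is_iso C A (Zs ! b) (q b \<cdot> i 0)"
    using local_factor_iso[OF A loc[OF b(1)] qi pj] b(2) by simp
  obtain Ws where Ws: "mset (Zs ! b # Ws) = mset Zs"
    "direct_sum_via C X (Zs ! b # Ws) (j \<circ> Transposition.transpose 0 b) (q \<circ> Transposition.transpose 0 b)"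
    using direct_sum_via_transpose[OF jq b(1)] by blast
  obtain B' where B': "direct_sum C B' Ws" using direct_sum_exists by blast
  obtain j' q' where "biproduct C X (Zs ! b) B' (j b) j' (q b) q'"
    using direct_sum_via_Cons[OF Ws(2) B'] by auto
  then have "isomorphic C A' B'" using biproduct_cancel[OF a] qi_iso by blast
  moreover have "set Ws \<subseteq> set Zs"
    using Ws(1) by (metis set_mset_mset set_subset_Cons)
  ultimately have "image_mset (iso_class C) (mset As) = image_mset (iso_class C) (mset Ws)"
    using Cons.prems by (intro Cons.IH[OF A' B']) auto
  moreover have "iso_class C A = iso_class C (Zs ! b)"
    using qi_iso unfolding iso_class_eq_iff isomorphic_def by blast
  ultimately show ?case unfolding Ws(1)[symmetric] by simp
qed

lemma K0_class_eq:
  assumes "direct_sum C X Ys" "\<forall>Y\<in>set Ys. indecomposable C Y"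
  shows "K0_class C X = (\<Sum>Y\<leftarrow>Ys. frag_of (iso_class C Y))"
  unfolding K0_class_def
proof (rule some_equality)
  fix v assume "\<exists>Zs. direct_sum C X Zs \<and> (\<forall>Z\<in>set Zs. indecomposable C Z) \<and>
    v = (\<Sum>Z\<leftarrow>Zs. frag_of (iso_class C Z))"
  then obtain Zs where Zs: "direct_sum C X Zs" "\<forall>Z\<in>set Zs. indecomposable C Z"
    "v = (\<Sum>Z\<leftarrow>Zs. frag_of (iso_class C Z))" by blast
  have "image_mset (iso_class C) (mset Zs) = image_mset (iso_class C) (mset Ys)"
    using decomposition_unique[OF Zs(1) assms(1) isomorphic_refl Zs(2) assms(2)] .
  then have "sum_mset (image_mset frag_of (image_mset (iso_class C) (mset Zs))) =
    sum_mset (image_mset frag_of (image_mset (iso_class C) (mset Ys)))"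
    by (simp only:)
  then have "sum_mset (mset (map (\<lambda>Z. frag_of (iso_class C Z)) Zs)) =
    sum_mset (mset (map (\<lambda>Y. frag_of (iso_class C Y)) Ys))"
    by (simp add: multiset.map_comp o_def)
  then show "v = (\<Sum>Y\<leftarrow>Ys. frag_of (iso_class C Y))"
    unfolding Zs(3) sum_mset_sum_list .
qed (use assms in blast)

lemma indecomposable_decomposition:
  obtains Ys where "direct_sum C X Ys" "\<forall>Y\<in>set Ys. indecomposable C Y"
  using krull_schmidt local_imp_indecomposable unfolding krull_remak_schmidt_def by metis

lemma K0_class_direct_sum:
  assumes "direct_sum C X [A, B]"
  shows "K0_class C X = K0_class C A + K0_class C B"
proof -
  obtain As where As: "direct_sum C A As" "\<forall>Y\<in>set As. indecomposable C Y"
    by (rule indecomposable_decomposition)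
  obtain Bs where Bs: "direct_sum C B Bs" "\<forall>Y\<in>set Bs. indecomposable C Y"
    by (rule indecomposable_decomposition)
  show ?thesis
    using K0_class_eq[OF direct_sum_append[OF assms As(1) Bs(1)]] K0_class_eq[OF As] K0_class_eq[OF Bs]
      As(2) Bs(2) by auto
qed

lemma K0_class_indecomposable: "indecomposable C X \<Longrightarrow> K0_class C X = frag_of (iso_class C X)"
  using K0_class_eq[OF direct_sum_singleton] by simp

lemma direct_summand_of_list:
  assumes "direct_sum C X Ys" "Y \<in> set Ys"
  shows "direct_summand C Y X"
proof -
  obtain i p where ip: "direct_sum_via C X Ys i p"
    using assms(1) unfolding direct_sum_iff_via by blast
  obtain b where b: "b < length Ys" "Ys ! b = Y" using assms(2) by (auto simp: in_set_conv_nth)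
  obtain Ws where "direct_sum C X (Y # Ws)"
    using direct_sum_via_transpose[OF ip b(1)] b(2) unfolding direct_sum_iff_via by blast
  moreover obtain W where "direct_sum C W Ws" using direct_sum_exists by blast
  ultimately show ?thesis unfolding direct_summand_def using direct_sum_Cons by blast
qed

lemma additive_decomposition:
  assumes "additive_subcategory C \<R>" "X \<in> \<R>"
  obtains Ys where "direct_sum C X Ys" "\<forall>Y\<in>set Ys. indecomposable C Y" "set Ys \<subseteq> \<R>"
proof -
  obtain Ys where Ys: "direct_sum C X Ys" "\<forall>Y\<in>set Ys. indecomposable C Y"
    by (rule indecomposable_decomposition)
  have "set Ys \<subseteq> \<R>"
    using direct_summand_of_list[OF Ys(1)] assms unfolding additive_subcategory_def by blast
  then show thesis using that Ys by blast
qed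

lemma K0_class_in_K0_split:
  assumes "additive_subcategory C \<R>" "X \<in> \<R>"
  shows "K0_class C X \<in> carrier (K0_split C \<R>)"
proof -
  obtain Ys where Ys: "direct_sum C X Ys" "\<forall>Y\<in>set Ys. indecomposable C Y" "set Ys \<subseteq> \<R>"
    using assms by (rule additive_decomposition)
  from Ys(2,3) have "Poly_Mapping.keys (\<Sum>Y\<leftarrow>Ys. frag_of (iso_class C Y)) \<subseteq>
      iso_class C ` {Y \<in> \<R>. indecomposable C Y}"
  proof (induction Ys)
    case (Cons Y Ys)
    then show ?case
      using keys_add[of "frag_of (iso_class C Y)" "\<Sum>Y\<leftarrow>Ys. frag_of (iso_class C Y)"] by auto
  qed simp
  then show ?thesis unfolding K0_split_def using K0_class_eq[OF Ys(1,2)] by simp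
qed

end


section \<open>Triangles\<close>

context triangulated_category
begin

lemma shift_Hom: "f \<in> Hom C X Y \<Longrightarrow> shift_mor C f \<in> Hom C (shift C X) (shift C Y)"
  using shift_bij unfolding bij_betw_def by blast

lemma shift_inj:
  "\<lbrakk>shift_mor C f = shift_mor C g; f \<in> Hom C X Y; g \<in> Hom C X Y\<rbrakk> \<Longrightarrow> f = g"
  using shift_bij unfolding bij_betw_def inj_on_def by blast

lemma shift_full:
  assumes "h \<in> Hom C (shift C X) (shift C Y)"
  obtains f where "f \<in> Hom C X Y" "h = shift_mor C f"
  using assms shift_bij[of X Y] unfolding bij_betw_def by blast

lemma shift_zero [simp]: "shift_mor C 0 = 0"
  using shift_add[OF zero_Hom zero_Hom] by simp

lemma shift_minus: "f \<in> Hom C X Y \<Longrightarrow> shift_mor C (- f) = - shift_mor C f"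
  using shift_add[of f X Y "- f"] minus_Hom[of f X Y]
    minus_unique[of "shift_mor C f" "shift_mor C (- f)"] by simp

lemma shift_sum:
  "(\<And>a. a \<in> A \<Longrightarrow> f a \<in> Hom C X Y) \<Longrightarrow> shift_mor C (sum f A) = (\<Sum>a\<in>A. shift_mor C (f a))"
  by (induction A rule: infinite_finite_induct) (auto simp: shift_add[of _ X Y] sum_Hom)

lemma shift_is_iso: "is_iso C X Y f \<Longrightarrow> is_iso C (shift C X) (shift C Y) (shift_mor C f)"
proof (elim is_isoE)
  fix g assume f: "f \<in> Hom C X Y" and g: "g \<in> Hom C Y X"
    and gf: "g \<cdot> f = ident C X" and fg: "f \<cdot> g = ident C Y"
  show ?thesis
    using shift_comp[OF f g] shift_comp[OF g f] gf fg shift_ident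
    by (intro is_isoI[OF shift_Hom[OF f] shift_Hom[OF g]]) simp_all
qed

lemma shift_isomorphic: "isomorphic C X Y \<Longrightarrow> isomorphic C (shift C X) (shift C Y)"
  unfolding isomorphic_def using shift_is_iso by blast

lemma shift_zero_object: "zero_object C X \<Longrightarrow> zero_object C (shift C X)"
  unfolding zero_object_iff using shift_ident[of X] by simp

lemma shift_direct_sum:
  assumes "direct_sum C X Ys"
  shows "direct_sum C (shift C X) (map (shift C) Ys)"
proof -
  obtain i p where "direct_sum_via C X Ys i p" using assms unfolding direct_sum_iff_via by blast
  note D = direct_sum_viaD[OF this]
  have "(\<Sum>a<length Ys. shift_mor C (i a) \<cdot> shift_mor C (p a)) =
      (\<Sum>a<length Ys. shift_mor C (i a \<cdot> p a))"
    by (intro sum.cong refl) (simp add: shift_comp[OF D(2,1)])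
  also have "\<dots> = ident C (shift C X)"
    using shift_sum[of "{..<length Ys}" "\<lambda>a. i a \<cdot> p a" X X] comp_closed[OF D(2) D(1)] D(4) shift_ident
    by simp
  finally have "direct_sum_via C (shift C X) (map (shift C) Ys)
      (\<lambda>a. shift_mor C (i a)) (\<lambda>a. shift_mor C (p a))"
    unfolding direct_sum_via_def
    using D shift_comp[OF D(1) D(2), symmetric] by (auto simp: shift_Hom shift_ident)
  then show ?thesis unfolding direct_sum_iff_via by blast
qed

lemma zero_object_exists: "\<exists>X. zero_object C X"
  using finite_direct_sums[of "[]"] direct_sum_Nil_iff by blast

lemma triangle_rotate:
  "triangle C X Y Z f g h \<Longrightarrow> triangle C Y Z (shift C X) g h (- shift_mor C f)"
  using TR2 triangle_Hom by blast

text \<open>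
  The backward rotation needs the first morphism to be given before its shift; it exists because
  the shift is full.
\<close>

lemma triangle_unrotate:
  assumes "triangle C Y Z (shift C X) g h k"
  obtains f where "triangle C X Y Z f g h"
proof -
  have "- k \<in> Hom C (shift C X) (shift C Y)"
    using triangle_Hom[OF assms] minus_Hom by blast
  then obtain f where f: "f \<in> Hom C X Y" "- k = shift_mor C f" by (rule shift_full)
  then have "k = - shift_mor C f" by (metis minus_minus)
  then show thesis using that assms TR2[OF f(1)] by blast
qed

lemma triangle_unshift:
  assumes "triangle C (shift C X) (shift C Y) (shift C Z) f g h"
  shows "\<exists>f g h. triangle C X Y Z f g h"
proof -
  obtain h' where "triangle C Z (shift C X) (shift C Y) h' f g"
    using assms by (rule triangle_unrotate)
  then obtain g' where "triangle C Y Z (shift C X) g' h' f" by (rule triangle_unrotate)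
  then obtain f' where "triangle C X Y Z f' g' h'" by (rule triangle_unrotate)
  then show ?thesis by blast
qed

lemma triangle_comp_zero:
  assumes T: "triangle C X Y Z f g h"
  shows "g \<cdot> f = 0"
proof -
  obtain N where N: "zero_object C N" using zero_object_exists by blast
  have f: "f \<in> Hom C X Y" using triangle_Hom[OF T] by blast
  have "f \<cdot> ident C X = f \<cdot> ident C X" ..
  then obtain c where "c \<in> Hom C N Z" "c \<cdot> 0 = g \<cdot> f"
    using TR3[OF TR1_ident[OF N] T ident_closed f] by blast
  then show ?thesis using comp_zero_right by metis
qed

lemma triangle_comp_zero': "triangle C X Y Z f g h \<Longrightarrow> h \<cdot> g = 0"
  using triangle_rotate triangle_comp_zero by blast

text \<open>
  Compare the rotated triangle \<open>W \<rightarrow> 0 \<rightarrow> W[1]\<close> with the rotation of the given one: the third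
  morphism of the comparison is the shift of the desired \<open>v\<close>.
\<close>

lemma triangle_lift:
  assumes T: "triangle C X Y Z f g h" and u: "u \<in> Hom C W Y" "g \<cdot> u = 0"
  obtains v where "v \<in> Hom C W X" "u = f \<cdot> v"
proof -
  obtain N where N: "zero_object C N" using zero_object_exists by blast
  have f: "f \<in> Hom C X Y" using triangle_Hom[OF T] by blast
  have "triangle C W N (shift C W) 0 0 (- ident C (shift C W))"
    using triangle_rotate[OF TR1_ident[OF N, of W]] by (simp add: shift_ident)
  moreover have "0 \<cdot> 0 = g \<cdot> u" using u comp_zero_left[OF zero_Hom] by simp
  ultimately obtain c where c: "c \<in> Hom C (shift C W) (shift C X)"
    "shift_mor C u \<cdot> (- ident C (shift C W)) = (- shift_mor C f) \<cdot> c"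
    using TR3[OF _ triangle_rotate[OF T] u(1) zero_Hom] by blast
  obtain v where v: "v \<in> Hom C W X" "c = shift_mor C v" using c(1) by (rule shift_full)
  have "shift_mor C u = shift_mor C (f \<cdot> v)"
    using c(2) comp_minus_right[OF ident_closed shift_Hom[OF u(1)]] comp_minus_left[OF c(1) shift_Hom[OF f]]
      ident_right[OF shift_Hom[OF u(1)]] shift_comp[OF v(1) f] v(2) by simp
  then have "u = f \<cdot> v" using shift_inj u(1) comp_closed[OF v(1) f] by blast
  then show thesis using that v(1) by blast
qed

text \<open>
  The dual weak cokernel property, by comparison with \<open>0 \<rightarrow> W \<rightarrow> W\<close>.
\<close>

lemma triangle_extend:
  assumes T: "triangle C X Y Z f g h" and u: "u \<in> Hom C Y W" "u \<cdot> f = 0"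
  obtains v where "v \<in> Hom C Z W" "u = v \<cdot> g"
proof -
  obtain N where N: "zero_object C N" using zero_object_exists by blast
  have "triangle C N W W 0 (ident C W) 0"
    using TR1_ident[OF shift_zero_object[OF N], of W] TR2[OF zero_Hom] by simp
  moreover have "u \<cdot> f = 0 \<cdot> 0" using u comp_zero_left[OF zero_Hom] by simp
  ultimately obtain c where "c \<in> Hom C Z W" "c \<cdot> g = ident C W \<cdot> u"
    using TR3[OF T _ zero_Hom u(1)] by blast
  then show thesis using that ident_left[OF u(1)] by metis
qed

lemma triangle_iso_third:
  assumes T: "triangle C X Y Z f g h" and "isomorphic C Z Z'"
  obtains g' h' where "triangle C X Y Z' f g' h'"
proof -
  obtain c where c: "is_iso C Z Z' c" using assms(2) unfolding isomorphic_def by blast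
  then obtain d where d: "c \<in> Hom C Z Z'" "d \<in> Hom C Z' Z" "d \<cdot> c = ident C Z" "c \<cdot> d = ident C Z'"
    by (elim is_isoE)
  have t: "f \<in> Hom C X Y" "g \<in> Hom C Y Z" "h \<in> Hom C Z (shift C X)"
    using triangle_Hom[OF T] by blast+
  have "ident C Y \<cdot> f = f \<cdot> ident C X" using ident_left ident_right t by simp
  moreover have "c \<cdot> g = c \<cdot> g \<cdot> ident C Y" using ident_right[OF comp_closed[OF t(2) d(1)]] by simp
  moreover have "shift_mor C (ident C X) \<cdot> h = h \<cdot> d \<cdot> c"
    using comp_assoc[OF d(1,2) t(3)] d(3) ident_right[OF t(3)] ident_left[OF t(3)] shift_ident by simp
  ultimately show thesis
    using that TR1_iso[OF T t(1) comp_closed[OF t(2) d(1)] comp_closed[OF d(2) t(3)] is_iso_ident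
        is_iso_ident c] by blast
qed

lemma triangle_fibre:
  assumes "g \<in> Hom C Y Z"
  shows "\<exists>X f h. triangle C X Y Z f g h"
proof -
  obtain V u v where T: "triangle C Y Z V g u v" using TR1_cone[OF assms] by blast
  obtain X where "isomorphic C V (shift C X)" using shift_ess_surj isomorphic_sym by blast
  then obtain u' v' where "triangle C Y Z (shift C X) g u' v'"
    using triangle_iso_third[OF T] by blast
  then obtain f where "triangle C X Y Z f g u'" by (rule triangle_unrotate)
  then show ?thesis by blast
qed

text \<open>
  The connecting morphism of the cone of a split monomorphism vanishes, so the cone is a
  cokernel, and \<open>q\<close> is another one.
\<close>

lemma biproduct_triangle:
  assumes b: "biproduct C W X Y i j p q"
  shows "triangle C X W Y i q 0"
proof -
  note b = biproductD[OF b]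
  obtain Z g h where T: "triangle C X W Z i g h" using TR1_cone[OF b(1)] by blast
  have t: "g \<in> Hom C W Z" "h \<in> Hom C Z (shift C X)"
    using triangle_Hom[OF T] by blast+
  note i' = shift_Hom[OF b(1)] and p' = shift_Hom[OF b(3)]
  \<comment> \<open>the shift of \<open>i\<close> is a split monomorphism that annihilates \<open>h\<close>\<close>
  have "(- shift_mor C i) \<cdot> h = 0" using triangle_comp_zero'[OF triangle_rotate[OF T]] .
  then have "shift_mor C i \<cdot> h = 0" using comp_minus_left[OF t(2) i'] by simp
  moreover have "shift_mor C p \<cdot> (shift_mor C i \<cdot> h) = h"
    using comp_cancel[OF _ i' p' t(2)] shift_comp[OF b(1,3)] b(5) shift_ident ident_left[OF t(2)]
    by simp
  ultimately have h0: "h = 0" using comp_zero_right[OF p'] by simp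
  obtain c where c: "c \<in> Hom C Z Y" "q = c \<cdot> g" using triangle_extend[OF T b(4,7)] by blast
  have s: "g \<cdot> j \<in> Hom C Y Z" by (rule comp_closed[OF b(2) t(1)])
  have cs: "c \<cdot> (g \<cdot> j) = ident C Y" using comp_assoc[OF b(2) t(1) c(1)] c(2) b(6) by simp
  have sc: "g \<cdot> j \<cdot> c \<in> Hom C Z Z" by (rule comp_closed[OF c(1) s])
  have gi: "g \<cdot> i = 0" by (rule triangle_comp_zero[OF T])
  have "g = g \<cdot> (i \<cdot> p + j \<cdot> q)" using b(9) ident_right[OF t(1)] by simp
  also have "\<dots> = g \<cdot> (i \<cdot> p) + g \<cdot> (j \<cdot> q)"
    by (rule comp_add_right[OF comp_closed[OF b(3,1)] comp_closed[OF b(4,2)] t(1)])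
  also have "\<dots> = g \<cdot> j \<cdot> q"
    using comp_cancel[OF gi b(1) t(1) b(3)] comp_zero_left[OF b(3)] comp_assoc[OF b(4,2) t(1)] by simp
  finally have "g \<cdot> j \<cdot> q = g" ..
  then have "(g \<cdot> j \<cdot> c - ident C Z) \<cdot> g = 0"
    using comp_diff_left[OF t(1) sc ident_closed] comp_assoc[OF t(1) c(1) s] c(2) ident_left[OF t(1)]
    by simp
  then obtain v where v: "v \<in> Hom C (shift C X) Z" "g \<cdot> j \<cdot> c - ident C Z = v \<cdot> h"
    using triangle_extend[OF triangle_rotate[OF T] diff_Hom[OF sc ident_closed]] by blast
  then have "g \<cdot> j \<cdot> c = ident C Z" using h0 comp_zero_right[OF v(1)] by simp
  then have "is_iso C Z Y c" using is_isoI[OF c(1) s] cs by simp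
  moreover have "ident C W \<cdot> i = i \<cdot> ident C X" "c \<cdot> g = q \<cdot> ident C W"
    using ident_left[OF b(1)] ident_right[OF b(1)] ident_right[OF b(4)] c(2) by simp_all
  moreover have "shift_mor C (ident C X) \<cdot> h = 0 \<cdot> c"
    using h0 shift_ident comp_zero_left[OF c(1)] comp_zero_right[OF ident_closed] by simp
  ultimately show ?thesis
    using TR1_iso[OF T b(1,4) zero_Hom is_iso_ident is_iso_ident] by blast
qed

lemma triangle_split:
  assumes T: "triangle C X Y Z f g 0"
  shows "direct_sum C Y [X, Z]"
proof -
  have t: "f \<in> Hom C X Y" "g \<in> Hom C Y Z" using triangle_Hom[OF T] by blast+
  have "0 \<cdot> ident C Z = 0" using comp_zero_left[OF ident_closed] .
  then obtain s where s: "s \<in> Hom C Z Y" "ident C Z = g \<cdot> s"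
    using triangle_lift[OF triangle_rotate[OF T] ident_closed] by blast
  have sg: "s \<cdot> g \<in> Hom C Y Y" by (rule comp_closed[OF t(2) s(1)])
  have "g \<cdot> (ident C Y - s \<cdot> g) = 0"
    using comp_diff_right[OF ident_closed sg t(2)] comp_assoc[OF t(2) s(1) t(2)] s(2)
      ident_left[OF t(2)] ident_right[OF t(2)] by simp
  then obtain p where p: "p \<in> Hom C Y X" "ident C Y - s \<cdot> g = f \<cdot> p"
    using triangle_lift[OF T diff_Hom[OF ident_closed sg]] by blast
  have gf: "g \<cdot> f = 0" by (rule triangle_comp_zero[OF T])
  \<comment> \<open>since the connecting morphism vanishes, \<open>f\<close> is a monomorphism\<close>
  have mono: "u = 0" if u: "u \<in> Hom C W X" "f \<cdot> u = 0" for u W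
  proof -
    have "(- shift_mor C f) \<cdot> shift_mor C u = 0"
      using comp_minus_left[OF shift_Hom[OF u(1)] shift_Hom[OF t(1)]] shift_comp[OF u(1) t(1)] u(2) by simp
    then obtain w where "w \<in> Hom C (shift C W) Z" "shift_mor C u = 0 \<cdot> w"
      using triangle_lift[OF triangle_rotate[OF triangle_rotate[OF T]] shift_Hom[OF u(1)]] by blast
    then have "shift_mor C u = shift_mor C 0" using comp_zero_left by simp
    then show ?thesis using shift_inj u(1) zero_Hom by blast
  qed
  have fpf: "f \<cdot> (p \<cdot> f) = f"
    using comp_diff_left[OF t(1) ident_closed sg] comp_assoc[OF t s(1)] gf comp_zero_right[OF s(1)]
      ident_left[OF t(1)] comp_assoc[OF t(1) p(1) t(1)] p(2) by simp
  have pf: "p \<cdot> f \<in> Hom C X X" by (rule comp_closed[OF t(1) p(1)])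
  have "p \<cdot> f - ident C X = 0"
    using comp_diff_right[OF pf ident_closed t(1)] fpf ident_right[OF t(1)]
    by (intro mono[OF diff_Hom[OF pf ident_closed]]) simp
  then have pf1: "p \<cdot> f = ident C X" by simp
  have "f \<cdot> (p \<cdot> s) = s - s \<cdot> (g \<cdot> s)"
    using comp_diff_left[OF s(1) ident_closed sg] comp_assoc[OF s(1) t(2) s(1)]
      ident_left[OF s(1)] comp_assoc[OF s(1) p(1) t(1)] p(2) by simp
  then have ps: "p \<cdot> s = 0"
    using s(2)[symmetric] ident_right[OF s(1)] by (intro mono[OF comp_closed[OF s(1) p(1)]]) simp
  have "f \<cdot> p + s \<cdot> g = ident C Y" using p(2)[symmetric] by simp
  then have "biproduct C Y X Z f s p g"
    unfolding biproduct_def using t s p gf pf1 ps by simp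
  then show ?thesis unfolding direct_sum_pair_iff by blast
qed

text \<open>
  The octahedral axiom for \<open>S\<^sub>0 \<rightarrow> Z \<rightarrow> X[1]\<close>: the cones of the two factors are
  \<open>S\<^sub>1[1]\<close> and \<open>Y[1]\<close>, and the cone of the composite, which is zero, is \<open>E[1]\<close> with
  \<open>E = X \<oplus> S\<^sub>0\<close>. The octahedron relates these three cones by a triangle.
\<close>

lemma homotopy_pullback:
  assumes T: "triangle C X Y Z f g h" and S: "triangle C S1 S0 Z a s b" and hs: "h \<cdot> s = 0"
  obtains E u v w where "direct_sum C E [X, S0]" "triangle C S1 E Y u v w"
proof -
  obtain E where E: "direct_sum C E [X, S0]" using finite_direct_sums by blast
  then obtain i j p q where "biproduct C E X S0 i j p q" unfolding direct_sum_pair_iff by blast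
  then have "triangle C S0 (shift C X) (shift C E) (h \<cdot> s) (- shift_mor C i) (- shift_mor C q)"
    using triangle_rotate[OF triangle_rotate[OF biproduct_triangle]] hs by simp
  then have "\<exists>a b c. triangle C (shift C S1) (shift C E) (shift C Y) a b c"
    using TR4[OF triangle_rotate[OF S] triangle_rotate[OF triangle_rotate[OF T]]] by blast
  then show thesis using that E triangle_unshift by blast
qed

end


section \<open>Rigid objects have an index\<close>

text \<open>
  \<open>Ext1 C Y X\<close> is in bijection with the dual of the zero space, which has one element.
\<close>

lemma calabi_yau_Ext1_vanishes:
  fixes C :: "('k::field, 'o, 'm::ab_group_add) tricat"
  assumes CY: "two_calabi_yau C" and XY: "Ext1 C X Y = {0}" and 0: "0 \<in> Ext1 C Y X"
  shows "Ext1 C Y X = {0}"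
proof -
  obtain \<Phi> :: "'o \<Rightarrow> 'o \<Rightarrow> 'm \<Rightarrow> 'm \<Rightarrow> 'k" where
    "\<forall>X Y. bij_betw (\<Phi> X Y) (Ext1 C X Y) (dual_space (scal C) (Ext1 C Y X))"
    using CY[unfolded two_calabi_yau_def] by (elim exE conjE)
  then have \<Phi>: "bij_betw (\<Phi> Y X) (Ext1 C Y X) (dual_space (scal C) (Ext1 C X Y))" by blast
  have "\<phi> = (\<lambda>x\<in>{0}. 0)" if "\<phi> \<in> dual_space (scal C) {0}" for \<phi> :: "'m \<Rightarrow> 'k"
  proof -
    have "\<phi> \<in> extensional {0}" "\<phi> (0 + 0) = \<phi> 0 + \<phi> 0"
      using that unfolding dual_space_def by blast+
    moreover from this have "\<phi> 0 = 0" by (metis add.right_neutral add_left_cancel)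
    ultimately show ?thesis by (intro extensionalityI[of _ "{0}"]) auto
  qed
  then have "\<Phi> Y X e = (\<lambda>x\<in>{0}. 0)" if "e \<in> Ext1 C Y X" for e
    using \<Phi> that unfolding XY bij_betw_def by blast
  then have "\<Phi> Y X e = \<Phi> Y X 0" if "e \<in> Ext1 C Y X" for e
    using that 0 by metis
  then have "e = 0" if "e \<in> Ext1 C Y X" for e
    using that 0 \<Phi> unfolding bij_betw_def inj_on_def by blast
  then show ?thesis using 0 by blast
qed

context triangulated_category
begin

lemma Ext1_zero: "0 \<in> Ext1 C X Y"
  unfolding Ext1_def by simp

lemma Ext1_shift_vanishes:
  assumes "Ext1 C X Y = {0}"
  shows "Ext1 C (shift C X) (shift C Y) = {0}"
  using shift_bij[of X "shift C Y"] assms unfolding Ext1_def bij_betw_def by auto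

text \<open>
  The identity of \<open>T\<close> is a sum of endomorphisms that factor through \<open>M\<close>.
\<close>

lemma add_closure_Hom_zero:
  assumes "T \<in> add_closure C M"
  shows "\<lbrakk>\<And>e. e \<in> Hom C M Z \<Longrightarrow> e = 0; e \<in> Hom C T Z\<rbrakk> \<Longrightarrow> e = 0"
    and "\<lbrakk>\<And>e. e \<in> Hom C Z M \<Longrightarrow> e = 0; e \<in> Hom C Z T\<rbrakk> \<Longrightarrow> e = 0"
proof -
  obtain X n T' where X: "direct_sum C X (replicate n M)" "direct_sum C X [T, T']"
    using assms unfolding add_closure_def direct_summand_def by blast
  obtain i p where ip: "direct_sum_via C X (replicate n M) i p"
    using X(1) unfolding direct_sum_iff_via by blast
  obtain i' j' p' q' where bip: "biproduct C X T T' i' j' p' q'"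
    using X(2) unfolding direct_sum_pair_iff by blast
  note b = biproductD[OF bip]
  have D: "i a \<in> Hom C M X" "p a \<in> Hom C X M" if "a < n" for a
    using direct_sum_viaD(1,2)[OF ip, of a] that by simp_all
  have S: "(\<Sum>a<n. i a \<cdot> p a) = ident C X" using direct_sum_viaD(4)[OF ip] by simp
  have ipH: "i a \<cdot> p a \<in> Hom C X X" if "a < n" for a by (rule comp_closed[OF D(2)[OF that] D(1)[OF that]])
  {
    assume 0: "\<And>e. e \<in> Hom C M Z \<Longrightarrow> e = 0" and e: "e \<in> Hom C T Z"
    have ep: "e \<cdot> p' \<in> Hom C X Z" by (rule comp_closed[OF b(3) e])
    have "e \<cdot> p' = e \<cdot> p' \<cdot> (\<Sum>a<n. i a \<cdot> p a)" using S ident_right[OF ep] by simp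
    also have "\<dots> = (\<Sum>a<n. e \<cdot> p' \<cdot> (i a \<cdot> p a))"
      by (rule comp_sum_right[OF ipH ep]) simp
    also have "\<dots> = 0"
    proof (intro sum.neutral ballI)
      fix a assume "a \<in> {..<n}"
      then have a: "a < n" by simp
      have "e \<cdot> p' \<cdot> i a = 0" by (rule 0[OF comp_closed[OF D(1)[OF a] ep]])
      then show "e \<cdot> p' \<cdot> (i a \<cdot> p a) = 0"
        using comp_assoc[OF D(2)[OF a] D(1)[OF a] ep] comp_zero_left[OF D(2)[OF a]] by simp
    qed
    finally have "e \<cdot> p' \<cdot> i' = 0" using comp_zero_left[OF b(1)] by simp
    then show "e = 0" using comp_assoc[OF b(1,3) e] b(5) ident_right[OF e] by simp
  }
  {
    assume 0: "\<And>e. e \<in> Hom C Z M \<Longrightarrow> e = 0" and e: "e \<in> Hom C Z T"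
    have ie: "i' \<cdot> e \<in> Hom C Z X" by (rule comp_closed[OF e b(1)])
    have "i' \<cdot> e = (\<Sum>a<n. i a \<cdot> p a) \<cdot> (i' \<cdot> e)" using S ident_left[OF ie] by simp
    also have "\<dots> = (\<Sum>a<n. i a \<cdot> p a \<cdot> (i' \<cdot> e))"
      by (rule comp_sum_left[OF ie ipH]) simp
    also have "\<dots> = 0"
    proof (intro sum.neutral ballI)
      fix a assume "a \<in> {..<n}"
      then have a: "a < n" by simp
      have "p a \<cdot> (i' \<cdot> e) = 0" by (rule 0[OF comp_closed[OF ie D(2)[OF a]]])
      then show "i a \<cdot> p a \<cdot> (i' \<cdot> e) = 0"
        using comp_assoc[OF ie D(2)[OF a] D(1)[OF a]] comp_zero_right[OF D(1)[OF a]] by simp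
    qed
    finally have "p' \<cdot> (i' \<cdot> e) = 0" using comp_zero_right[OF b(3)] by simp
    then show "e = 0" using comp_cancel[OF b(5,1,3) e] ident_left[OF e] by simp
  }
qed

lemma add_closure_shift:
  assumes "T \<in> add_closure C M"
  shows "shift C T \<in> add_closure C (shift C M)"
proof -
  obtain X n T' where X: "direct_sum C X (replicate n M)" "direct_sum C X [T, T']"
    using assms unfolding add_closure_def direct_summand_def by blast
  have "direct_sum C (shift C X) (replicate n (shift C M))"
    using shift_direct_sum[OF X(1)] by simp
  moreover have "direct_summand C (shift C T) (shift C X)"
    unfolding direct_summand_def using shift_direct_sum[OF X(2)] by auto
  ultimately show ?thesis unfolding add_closure_def by blast
qed

text \<open>
  Maximality is a condition on \<open>add M\<close>; it suffices to test vanishing on \<open>M\<close> itself.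
\<close>

lemma maximal_rigid_memI:
  assumes \<R>: "maximal_rigid C \<R>"
    and l: "\<And>R. R \<in> \<R> \<Longrightarrow> Ext1 C R M = {0}" and r: "\<And>R. R \<in> \<R> \<Longrightarrow> Ext1 C M R = {0}"
    and M: "Ext1 C M M = {0}"
  shows "M \<in> \<R>"
proof -
  have van: "Ext1 C R R' = {0}" if "R \<in> \<R>" "R' \<in> \<R>" for R R'
    using \<R> that unfolding maximal_rigid_def rigid_subcategory_def Ext1_vanishes_def by blast
  have left: "Ext1 C T Z = {0}" if T: "T \<in> add_closure C M" and MZ: "Ext1 C M Z = {0}" for T Z
  proof -
    have "d = 0" if "d \<in> Hom C M (shift C Z)" for d using MZ that unfolding Ext1_def by blast
    then have "e = 0" if "e \<in> Ext1 C T Z" for e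
      using add_closure_Hom_zero(1)[OF T] that unfolding Ext1_def by blast
    then show ?thesis using Ext1_zero by blast
  qed
  have right: "Ext1 C Z T = {0}" if T: "T \<in> add_closure C M" and ZM: "Ext1 C Z M = {0}" for T Z
  proof -
    have "d = 0" if "d \<in> Hom C Z (shift C M)" for d using ZM that unfolding Ext1_def by blast
    then have "e = 0" if "e \<in> Ext1 C Z T" for e
      using add_closure_Hom_zero(2)[OF add_closure_shift[OF T]] that unfolding Ext1_def by blast
    then show ?thesis using Ext1_zero by blast
  qed
  have "Ext1 C T T' = {0}" if "T \<in> \<R> \<union> add_closure C M" "T' \<in> \<R> \<union> add_closure C M" for T T'
    using that by (elim UnE) (use van left[OF _ r] right[OF _ l] left[OF _ right[OF _ M]] in simp_all)
  then have "Ext1_vanishes C (\<R> \<union> add_closure C M)"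
    unfolding Ext1_vanishes_def by blast
  then show ?thesis using \<R> unfolding maximal_rigid_def by blast
qed

text \<open>
  Complete a right approximation \<open>g : T \<rightarrow> X\<close> to a triangle \<open>Y \<rightarrow> T \<rightarrow> X \<rightarrow> Y[1]\<close> with
  morphisms \<open>f\<close>, \<open>g\<close>, \<open>h\<close>. It remains to see that \<open>Y\<close> lies in \<open>\<R>\<close>, which by
  maximality amounts to the vanishing of \<open>Ext1\<close> from \<open>\<R>\<close> to \<open>Y\<close>, from \<open>Y\<close> to \<open>\<R>\<close>, and
  from \<open>Y\<close> to itself. If \<open>Ext1\<close> from \<open>W\<close> to \<open>T\<close> vanishes, then every morphism
  \<open>W \<rightarrow> Y[1]\<close> has the form \<open>h w\<close>, and \<open>h w = 0\<close> as soon as \<open>w\<close> factors through \<open>g\<close>.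
  For \<open>w : R \<rightarrow> X\<close> with \<open>R\<close> in \<open>\<R>\<close> this is the approximation property, and the
  Calabi-Yau duality then exchanges the arguments. For \<open>w : Y \<rightarrow> X\<close>, rigidity of \<open>X\<close> extends
  \<open>w\<close> along \<open>f\<close> to a morphism \<open>T \<rightarrow> X\<close>, to which the approximation property applies.
\<close>

lemma rigid_presentation:
  assumes CY: "two_calabi_yau C" and \<R>: "maximal_rigid C \<R>" and fin: "contravariantly_finite C \<R>"
    and X: "Ext1 C X X = {0}"
  shows "\<exists>R\<^sub>0\<in>\<R>. \<exists>R\<^sub>1\<in>\<R>. \<exists>f g h. triangle C R\<^sub>1 R\<^sub>0 X f g h"
proof -
  have van: "Ext1 C R R' = {0}" if "R \<in> \<R>" "R' \<in> \<R>" for R R'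
    using \<R> that unfolding maximal_rigid_def rigid_subcategory_def Ext1_vanishes_def by blast
  obtain T g where T: "T \<in> \<R>" "g \<in> Hom C T X"
    and approx: "\<And>T' u. T' \<in> \<R> \<Longrightarrow> u \<in> Hom C T' X \<Longrightarrow> \<exists>v\<in>Hom C T' T. u = g \<cdot> v"
    using fin unfolding contravariantly_finite_def by metis
  obtain Y f h where tri: "triangle C Y T X f g h" using triangle_fibre[OF T(2)] by blast
  have t: "f \<in> Hom C Y T" "h \<in> Hom C X (shift C Y)" using triangle_Hom[OF tri] by blast+
  note f' = shift_Hom[OF t(1)]
  note tri2 = triangle_rotate[OF triangle_rotate[OF tri]]
  have hg: "h \<cdot> g = 0" by (rule triangle_comp_zero'[OF tri])
  have lift: "\<exists>w\<in>Hom C W X. e = h \<cdot> w"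
    if "Ext1 C W T = {0}" and e: "e \<in> Ext1 C W Y" for W e
  proof -
    have e': "e \<in> Hom C W (shift C Y)" using e unfolding Ext1_def .
    have "shift_mor C f \<cdot> e = 0"
      using comp_closed[OF e' f'] that(1) unfolding Ext1_def by simp
    then have "(- shift_mor C f) \<cdot> e = 0" using comp_minus_left[OF e' f'] by simp
    then obtain w where "w \<in> Hom C W X" "e = h \<cdot> w" by (rule triangle_lift[OF tri2 e'])
    then show ?thesis by blast
  qed
  have vanish: "h \<cdot> (g \<cdot> v) = 0" if "v \<in> Hom C W T" for v W
    using comp_cancel[OF hg T(2) t(2) that] comp_zero_left[OF that] by simp
  have RY: "Ext1 C R Y = {0}" if R: "R \<in> \<R>" for R
  proof -
    have "e = 0" if e: "e \<in> Ext1 C R Y" for e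
    proof -
      obtain w where w: "w \<in> Hom C R X" "e = h \<cdot> w" using lift[OF van[OF R T(1)] e] by blast
      then show ?thesis using approx[OF R w(1)] vanish by blast
    qed
    then show ?thesis using Ext1_zero by blast
  qed
  have YR: "Ext1 C Y R = {0}" if R: "R \<in> \<R>" for R
    by (rule calabi_yau_Ext1_vanishes[OF CY RY[OF R] Ext1_zero])
  have "e = 0" if e: "e \<in> Ext1 C Y Y" for e
  proof -
    obtain w where w: "w \<in> Hom C Y X" "e = h \<cdot> w" using lift[OF YR[OF T(1)] e] by blast
    \<comment> \<open>\<open>w\<close> extends along \<open>f\<close> because \<open>X\<close> is rigid\<close>
    have "shift_mor C w \<cdot> h = 0"
      using comp_closed[OF t(2) shift_Hom[OF w(1)]] X unfolding Ext1_def by simp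
    then obtain b' where b': "b' \<in> Hom C (shift C T) (shift C X)"
      "shift_mor C w = b' \<cdot> (- shift_mor C f)"
      using triangle_extend[OF tri2 shift_Hom[OF w(1)]] by blast
    obtain b where b: "b \<in> Hom C T X" "b' = shift_mor C b" using b'(1) by (rule shift_full)
    have "shift_mor C w = shift_mor C (- (b \<cdot> f))"
      using b' b comp_minus_right[OF f' b'(1)] shift_comp[OF t(1) b(1)]
        shift_minus[OF comp_closed[OF t(1) b(1)]] by simp
    then have w2: "w = - (b \<cdot> f)"
      using shift_inj w(1) minus_Hom[OF comp_closed[OF t(1) b(1)]] by blast
    obtain v where v: "v \<in> Hom C T T" "b = g \<cdot> v" using approx[OF T(1) b(1)] by blast
    have vf: "v \<cdot> f \<in> Hom C Y T" by (rule comp_closed[OF t(1) v(1)])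
    have "w = - (g \<cdot> (v \<cdot> f))" using w2 v(2) comp_assoc[OF t(1) v(1) T(2)] by simp
    then show ?thesis
      using w(2) comp_minus_right[OF comp_closed[OF vf T(2)] t(2)] vanish[OF vf] by simp
  qed
  then have "Ext1 C Y Y = {0}" using Ext1_zero by blast
  then have "Y \<in> \<R>" using maximal_rigid_memI[OF \<R> RY YR] by blast
  then show ?thesis using T(1) tri by blast
qed

end


section \<open>Additivity of the index\<close>

locale krull_schmidt_triangulated_category = triangulated_category +
  assumes krs: "krull_remak_schmidt C"

sublocale krull_schmidt_triangulated_category \<subseteq> krull_schmidt_category
  by unfold_locales (rule finite_direct_sums, rule krs)

text \<open>
  The graph of the index: a relation makes existence and uniqueness of the value separate
  statements, which the description by choice in \<open>ind\<close> conflates.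
\<close>

definition has_index ::
  "('k, 'o, 'm::ab_group_add) tricat \<Rightarrow> 'o set \<Rightarrow> 'o \<Rightarrow> ('o set \<Rightarrow>\<^sub>0 int) \<Rightarrow> bool" where
  "has_index C \<R> X v \<longleftrightarrow> (\<exists>R\<^sub>0\<in>\<R>. \<exists>R\<^sub>1\<in>\<R>. \<exists>f g h.
     triangle C R\<^sub>1 R\<^sub>0 X f g h \<and> v = K0_class C R\<^sub>0 - K0_class C R\<^sub>1)"

context krull_schmidt_triangulated_category
begin

context
  fixes \<R>
  assumes rigid: "rigid_subcategory C \<R>"
begin

lemma rigid_Hom_zero: "\<lbrakk>R \<in> \<R>; R' \<in> \<R>; e \<in> Hom C R (shift C R')\<rbrakk> \<Longrightarrow> e = 0"
  using rigid unfolding rigid_subcategory_def Ext1_vanishes_def Ext1_def by blast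

lemma rigid_direct_sum: "\<lbrakk>R \<in> \<R>; R' \<in> \<R>; direct_sum C E [R, R']\<rbrakk> \<Longrightarrow> E \<in> \<R>"
proof -
  assume "R \<in> \<R>" "R' \<in> \<R>" and E: "direct_sum C E [R, R']"
  then have "set [R, R'] \<subseteq> \<R>" by simp
  then show ?thesis
    using E rigid unfolding rigid_subcategory_def additive_subcategory_def by blast
qed

text \<open>
  The pullback of \<open>S\<^sub>0 \<rightarrow> Z\<close> along \<open>Y \<rightarrow> Z\<close> splits off \<open>X\<close>, since
  \<open>S\<^sub>0 \<rightarrow> Z \<rightarrow> X[1]\<close> lies in \<open>Ext1 C S0 X = {0}\<close>; with \<open>S\<^sub>1\<close> it presents \<open>Y\<close>.
\<close>

lemma has_index_extension:
  assumes X: "X \<in> \<R>" and T: "triangle C X Y Z f g h" and Z: "has_index C \<R> Z v"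
  shows "has_index C \<R> Y (K0_class C X + v)"
proof -
  obtain S0 S1 a s b where S: "S0 \<in> \<R>" "S1 \<in> \<R>" "triangle C S1 S0 Z a s b"
    "v = K0_class C S0 - K0_class C S1"
    using Z unfolding has_index_def by blast
  have "h \<cdot> s \<in> Hom C S0 (shift C X)"
    using triangle_Hom[OF T] triangle_Hom[OF S(3)] comp_closed by blast
  then have "h \<cdot> s = 0" by (rule rigid_Hom_zero[OF S(1) X])
  then obtain E c d e where E: "direct_sum C E [X, S0]" "triangle C S1 E Y c d e"
    using homotopy_pullback[OF T S(3)] by blast
  have "K0_class C X + v = K0_class C E - K0_class C S1"
    using K0_class_direct_sum[OF E(1)] S(4) by simp
  then show ?thesis
    unfolding has_index_def using rigid_direct_sum[OF X S(1) E(1)] S(2) E(2) by blast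
qed

lemma rigid_triangle_split:
  assumes "R \<in> \<R>" "R' \<in> \<R>" "triangle C R E R' f g h"
  shows "direct_sum C E [R, R']"
proof -
  have "h = 0" using rigid_Hom_zero[OF assms(2,1)] triangle_Hom[OF assms(3)] by blast
  then show ?thesis using triangle_split assms(3) by blast
qed

text \<open>
  Schanuel's argument: the pullback of two presentations of \<open>X\<close> is both
  \<open>R\<^sub>1 \<oplus> S\<^sub>0\<close> and \<open>S\<^sub>1 \<oplus> R\<^sub>0\<close>.
\<close>

lemma has_index_unique:
  assumes "has_index C \<R> X v" "has_index C \<R> X v'"
  shows "v = v'"
proof -
  obtain R0 R1 f g h where R: "R0 \<in> \<R>" "R1 \<in> \<R>" "triangle C R1 R0 X f g h"
    "v = K0_class C R0 - K0_class C R1"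
    using assms(1) unfolding has_index_def by blast
  obtain S0 S1 a s b where S: "S0 \<in> \<R>" "S1 \<in> \<R>" "triangle C S1 S0 X a s b"
    "v' = K0_class C S0 - K0_class C S1"
    using assms(2) unfolding has_index_def by blast
  have "h \<cdot> s \<in> Hom C S0 (shift C R1)"
    using triangle_Hom[OF R(3)] triangle_Hom[OF S(3)] comp_closed by blast
  then have "h \<cdot> s = 0" by (rule rigid_Hom_zero[OF S(1) R(2)])
  then obtain E c d e where E: "direct_sum C E [R1, S0]" "triangle C S1 E R0 c d e"
    using homotopy_pullback[OF R(3) S(3)] by blast
  have "direct_sum C E [S1, R0]" by (rule rigid_triangle_split[OF S(2) R(1) E(2)])
  then have "K0_class C R0 + K0_class C S1 = K0_class C S0 + K0_class C R1"
    using K0_class_direct_sum[OF E(1)] K0_class_direct_sum[of E S1 R0] by (simp add: add.commute)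
  then show ?thesis unfolding R(4) S(4) by (simp add: diff_eq_eq diff_add_eq eq_diff_eq)
qed

lemma ind_eq: "has_index C \<R> X v \<Longrightarrow> ind C \<R> X = v"
  unfolding ind_def has_index_def[symmetric]
  using has_index_unique by (intro some_equality) blast+

lemma has_index_iso:
  assumes "has_index C \<R> X v" "isomorphic C X X'"
  shows "has_index C \<R> X' v"
proof -
  obtain R0 R1 f g h where R: "R0 \<in> \<R>" "R1 \<in> \<R>" "triangle C R1 R0 X f g h"
    "v = K0_class C R0 - K0_class C R1"
    using assms(1) unfolding has_index_def by blast
  obtain g' h' where "triangle C R1 R0 X' f g' h'" by (rule triangle_iso_third[OF R(3) assms(2)])
  then show ?thesis unfolding has_index_def using R by blast
qed

text \<open>
  A horseshoe construction by two pullbacks along split triangles: \<open>E = X \<oplus> S\<^sub>0\<close> maps to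
  \<open>W\<close> with fibre \<open>S\<^sub>1\<close>, and \<open>F = S\<^sub>0 \<oplus> R\<^sub>0\<close> maps to \<open>E\<close> with fibre \<open>R\<^sub>1\<close>. The
  octahedral axiom makes the fibre of \<open>F \<rightarrow> W\<close> an extension of \<open>S\<^sub>1\<close> by \<open>R\<^sub>1\<close>.
\<close>

lemma has_index_direct_sum:
  assumes W: "direct_sum C W [X, Z]" and X: "has_index C \<R> X v" and Z: "has_index C \<R> Z w"
  shows "has_index C \<R> W (v + w)"
proof -
  obtain R0 R1 f g h where R: "R0 \<in> \<R>" "R1 \<in> \<R>" "triangle C R1 R0 X f g h"
    "v = K0_class C R0 - K0_class C R1"
    using X unfolding has_index_def by blast
  obtain S0 S1 a s b where S: "S0 \<in> \<R>" "S1 \<in> \<R>" "triangle C S1 S0 Z a s b"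
    "w = K0_class C S0 - K0_class C S1"
    using Z unfolding has_index_def by blast
  obtain i q where XWZ: "triangle C X W Z i q 0"
    using W biproduct_triangle unfolding direct_sum_pair_iff by blast
  have "0 \<cdot> s = 0" using triangle_Hom[OF S(3)] comp_zero_left by blast
  then obtain E u1 u2 u3 where E: "direct_sum C E [X, S0]" "triangle C S1 E W u1 u2 u3"
    using homotopy_pullback[OF XWZ S(3)] by blast
  obtain i' q' where SEX: "triangle C S0 E X i' q' 0"
    using direct_sum_pair_commute[OF E(1)] biproduct_triangle unfolding direct_sum_pair_iff by blast
  have "0 \<cdot> g = 0" using triangle_Hom[OF R(3)] comp_zero_left by blast
  then obtain F v1 v2 v3 where F: "direct_sum C F [S0, R0]" "triangle C R1 F E v1 v2 v3"
    using homotopy_pullback[OF SEX R(3)] by blast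
  \<comment> \<open>the cocone of the composite \<open>F \<rightarrow> E \<rightarrow> W\<close> is an extension of \<open>S1\<close> by \<open>R1\<close>\<close>
  have "u2 \<cdot> v2 \<in> Hom C F W"
    using triangle_Hom[OF E(2)] triangle_Hom[OF F(2)] comp_closed by blast
  then obtain P k l where P: "triangle C P F W k (u2 \<cdot> v2) l" using triangle_fibre by blast
  obtain m n o' where "triangle C (shift C R1) (shift C P) (shift C S1) m n o'"
    using TR4[OF triangle_rotate[OF F(2)] triangle_rotate[OF E(2)] triangle_rotate[OF P]] by blast
  then obtain m' n' o'' where "triangle C R1 P S1 m' n' o''"
    using triangle_unshift by blast
  then have PRS: "direct_sum C P [R1, S1]" using rigid_triangle_split R(2) S(2) by blast
  have "v + w = K0_class C F - K0_class C P"
    using K0_class_direct_sum[OF PRS] K0_class_direct_sum[OF F(1)] R(4) S(4) by simp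
  moreover have "F \<in> \<R>" "P \<in> \<R>"
    using rigid_direct_sum[OF S(1) R(1) F(1)] rigid_direct_sum[OF R(2) S(2) PRS] .
  ultimately show ?thesis
    unfolding has_index_def using P by (intro bexI[of _ F] bexI[of _ P] exI conjI)
qed

lemma has_index_sum_list:
  assumes "direct_sum C X Ys" "\<forall>Y\<in>set Ys. has_index C \<R> Y (v Y)"
  shows "has_index C \<R> X (\<Sum>Y\<leftarrow>Ys. v Y)"
  using assms
proof (induction Ys arbitrary: X)
  case Nil
  have "set [] \<subseteq> \<R>" by simp
  then have X: "X \<in> \<R>"
    using rigid Nil(1) unfolding rigid_subcategory_def additive_subcategory_def by blast
  have "triangle C X X X (ident C X) 0 0"
    using TR1_ident Nil(1) direct_sum_Nil_iff by blast
  then have "has_index C \<R> X (K0_class C X - K0_class C X)"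
    unfolding has_index_def using X by blast
  then show ?case by simp
next
  case (Cons Y Ys)
  obtain D where D: "direct_sum C D Ys" using finite_direct_sums by blast
  have "has_index C \<R> D (\<Sum>Y\<leftarrow>Ys. v Y)" using Cons.IH[OF D] Cons.prems by simp
  then show ?case
    using has_index_direct_sum[OF direct_sum_Cons[OF Cons.prems(1) D]] Cons.prems by simp
qed

end

end


section \<open>The index and the shifted index are mutually inverse\<close>

context krull_schmidt_triangulated_category
begin

lemma maximal_rigid_has_index:
  assumes CY: "two_calabi_yau C" and \<R>: "maximal_rigid C \<R>" and fin: "contravariantly_finite C \<R>"
    and X: "Ext1 C X X = {0}"
  shows "has_index C \<R> X (ind C \<R> X)"
proof -
  have rigid: "rigid_subcategory C \<R>" using \<R> unfolding maximal_rigid_def by blast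
  obtain v where "has_index C \<R> X v"
    using rigid_presentation[OF assms] unfolding has_index_def by blast
  then show ?thesis using ind_eq[OF rigid] by metis
qed

lemma member_Ext1_vanishes:
  assumes "rigid_subcategory C \<R>" "X \<in> \<R>"
  shows "Ext1 C X X = {0}"
  using assms unfolding rigid_subcategory_def Ext1_vanishes_def by blast

text \<open>
  Surjectivity of the index map. The shifted object \<open>X[1]\<close> is again rigid, and its presentation
  \<open>A \<rightarrow> B \<rightarrow> X[1]\<close> by \<open>\<R>'\<close> rotates to the triangle \<open>X \<rightarrow> A \<rightarrow> B \<rightarrow> X[1]\<close>.
\<close>

lemma K0_class_as_index_difference:
  assumes CY: "two_calabi_yau C"
    and \<R>: "maximal_rigid C \<R>" "contravariantly_finite C \<R>"
    and \<R>': "maximal_rigid C \<R>'" "contravariantly_finite C \<R>'" and X: "X \<in> \<R>"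
  obtains A B where "A \<in> \<R>'" "B \<in> \<R>'" "K0_class C X = ind C \<R> A - ind C \<R> B"
proof -
  have rigid: "rigid_subcategory C \<R>" "rigid_subcategory C \<R>'"
    using \<R> \<R>' unfolding maximal_rigid_def by blast+
  have "Ext1 C (shift C X) (shift C X) = {0}"
    using Ext1_shift_vanishes[OF member_Ext1_vanishes[OF rigid(1) X]] .
  then obtain A B f g h where AB: "A \<in> \<R>'" "B \<in> \<R>'" "triangle C A B (shift C X) f g h"
    using rigid_presentation[OF CY \<R>'] by blast
  obtain e where T: "triangle C X A B e f g" using AB(3) by (rule triangle_unrotate)
  have "has_index C \<R> B (ind C \<R> B)"
    using maximal_rigid_has_index[OF CY \<R> member_Ext1_vanishes[OF rigid(2) AB(2)]] .
  then have "ind C \<R> A = K0_class C X + ind C \<R> B"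
    using ind_eq[OF rigid(1) has_index_extension[OF rigid(1) X T]] by blast
  then show thesis using that AB(1,2) by simp
qed

text \<open>
  The same additivity with the roles of \<open>\<R>\<close> and \<open>\<R>'\<close> exchanged, for the rotated triangle
  \<open>Y \<rightarrow> R\<^sub>1[1] \<rightarrow> R\<^sub>0[1] \<rightarrow> Y[1]\<close>.
\<close>

lemma K0_class_as_shifted_index_difference:
  assumes CY: "two_calabi_yau C"
    and rigid: "rigid_subcategory C \<R>"
    and \<R>': "maximal_rigid C \<R>'" "contravariantly_finite C \<R>'" and Y: "Y \<in> \<R>'"
    and R: "R\<^sub>0 \<in> \<R>" "triangle C R\<^sub>1 R\<^sub>0 Y f g h"
  shows "K0_class C Y = ind C \<R>' (shift C R\<^sub>1) - ind C \<R>' (shift C R\<^sub>0)"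
proof -
  have rigid': "rigid_subcategory C \<R>'" using \<R>' unfolding maximal_rigid_def by blast
  have "Ext1 C (shift C R\<^sub>0) (shift C R\<^sub>0) = {0}"
    using Ext1_shift_vanishes[OF member_Ext1_vanishes[OF rigid R(1)]] .
  then have "has_index C \<R>' (shift C R\<^sub>0) (ind C \<R>' (shift C R\<^sub>0))"
    using maximal_rigid_has_index[OF CY \<R>'] by blast
  then have "ind C \<R>' (shift C R\<^sub>1) = K0_class C Y + ind C \<R>' (shift C R\<^sub>0)"
    using ind_eq[OF rigid'] has_index_extension[OF rigid' Y triangle_rotate[OF triangle_rotate[OF R(2)]]]
    by blast
  then show ?thesis by simp
qed

text \<open>
  The homomorphism given by \<open>\<psi>\<close> sends the class of \<open>X\<close> in \<open>\<R>\<close> to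
  \<open>- ind\<^bsub>\<R>'\<^esub>(X[1])\<close>, so it sends \<open>[R\<^sub>0] - [R\<^sub>1]\<close> to the difference in the previous lemma.
\<close>

lemma index_left_inverse:
  assumes CY: "two_calabi_yau C"
    and \<R>: "maximal_rigid C \<R>" "contravariantly_finite C \<R>"
    and \<R>': "maximal_rigid C \<R>'" "contravariantly_finite C \<R>'"
  shows "\<exists>\<psi>. \<forall>Y\<in>\<R>'. frag_extend \<psi> (ind C \<R> Y) = K0_class C Y"
proof -
  have rigid: "rigid_subcategory C \<R>" "rigid_subcategory C \<R>'"
    using \<R> \<R>' unfolding maximal_rigid_def by blast+
  have add: "additive_subcategory C \<R>" using rigid(1) unfolding rigid_subcategory_def by blast
  \<comment> \<open>the index being invariant under isomorphism, any object of the class \<open>c\<close> will do\<close>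
  define \<psi> where "\<psi> c = - ind C \<R>' (shift C (SOME X. iso_class C X = c))" for c
  have index: "has_index C \<R>' (shift C X) (ind C \<R>' (shift C X))" if "X \<in> \<R>" for X
    using maximal_rigid_has_index[OF CY \<R>' Ext1_shift_vanishes] member_Ext1_vanishes[OF rigid(1) that]
    by blast
  have \<psi>: "\<psi> (iso_class C X) = - ind C \<R>' (shift C X)" if "X \<in> \<R>" for X
  proof -
    let ?X = "SOME X'. iso_class C X' = iso_class C X"
    have "iso_class C ?X = iso_class C X" by (rule someI_ex) blast
    then have "isomorphic C (shift C X) (shift C ?X)"
      using iso_class_eq_iff isomorphic_sym shift_isomorphic by blast
    then show ?thesis
      using ind_eq[OF rigid(2) has_index_iso[OF rigid(2) index[OF that]]] unfolding \<psi>_def by simp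
  qed
  have K0: "frag_extend \<psi> (K0_class C X) = - ind C \<R>' (shift C X)" if X: "X \<in> \<R>" for X
  proof -
    obtain Ys where Ys: "direct_sum C X Ys" "\<forall>Y\<in>set Ys. indecomposable C Y" "set Ys \<subseteq> \<R>"
      using add X by (rule additive_decomposition)
    have "has_index C \<R>' (shift C X) (\<Sum>Z\<leftarrow>map (shift C) Ys. ind C \<R>' Z)"
      using has_index_sum_list[OF rigid(2) shift_direct_sum[OF Ys(1)]] index Ys(3) by auto
    then have "ind C \<R>' (shift C X) = (\<Sum>Y\<leftarrow>Ys. ind C \<R>' (shift C Y))"
      using ind_eq[OF rigid(2)] by (simp add: o_def)
    moreover from Ys(3) have "frag_extend \<psi> (\<Sum>Y\<leftarrow>Ys. frag_of (iso_class C Y)) =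
        - (\<Sum>Y\<leftarrow>Ys. ind C \<R>' (shift C Y))"
      by (induction Ys) (simp_all add: frag_extend_add \<psi>)
    ultimately show ?thesis using K0_class_eq[OF Ys(1,2)] by simp
  qed
  have "frag_extend \<psi> (ind C \<R> Y) = K0_class C Y" if Y: "Y \<in> \<R>'" for Y
  proof -
    obtain R\<^sub>0 R\<^sub>1 f g h where R: "R\<^sub>0 \<in> \<R>" "R\<^sub>1 \<in> \<R>" "triangle C R\<^sub>1 R\<^sub>0 Y f g h"
      "ind C \<R> Y = K0_class C R\<^sub>0 - K0_class C R\<^sub>1"
      using maximal_rigid_has_index[OF CY \<R> member_Ext1_vanishes[OF rigid(2) Y]]
      unfolding has_index_def by blast
    then show ?thesis
      using K0_class_as_shifted_index_difference[OF CY rigid(1) \<R>' Y R(1,3)] K0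
      by (simp add: frag_extend_diff)
  qed
  then show ?thesis by blast
qed

end


section \<open>Bases of free abelian groups\<close>

lemma frag_lookup_sum:
  assumes "finite t" "inj_on c t" "v \<in> t"
  shows "Poly_Mapping.lookup (\<Sum>w\<in>t. frag_cmul (u w) (frag_of (c w))) (c v) = u v"
proof -
  have "Poly_Mapping.lookup (\<Sum>w\<in>t. frag_cmul (u w) (frag_of (c w))) (c v) =
      (\<Sum>w\<in>t. if w = v then u w else 0)"
    unfolding lookup_sum using assms
    by (intro sum.cong refl) (auto simp: lookup_single when_def dest: inj_onD)
  then show ?thesis using assms by simp
qed

text \<open>
  A homomorphism that carries the family to pairwise distinct basis elements detects every linear
  relation.
\<close>

lemma independent_of_left_inverse:
  assumes \<psi>: "\<And>i. i \<in> I \<Longrightarrow> frag_extend \<psi> (b i) = frag_of (c i)" and c: "inj_on c I"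
  shows "inj_on b I" and "module.independent frag_cmul (b ` I)"
proof -
  show inj: "inj_on b I"
  proof (rule inj_onI)
    fix i j assume "i \<in> I" "j \<in> I" "b i = b j"
    then have "frag_of (c i) = frag_of (c j)" using \<psi> by metis
    then have "{c i} = {c j}" by (metis keys_frag_of)
    then show "i = j" using c \<open>i \<in> I\<close> \<open>j \<in> I\<close> by (auto dest: inj_onD)
  qed
  let ?i = "inv_into I b"
  interpret F: module frag_cmul by (rule module_frag_cmul)
  show "F.independent (b ` I)"
    unfolding F.independent_explicit_module
  proof (intro allI impI)
    fix t u v
    assume t: "finite t" "t \<subseteq> b ` I" and 0: "(\<Sum>w\<in>t. frag_cmul (u w) w) = 0" and v: "v \<in> t"
    have "inj_on ?i t" "?i ` t \<subseteq> I"
      using t(2) by (auto intro: inj_on_inv_into inv_into_into)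
    then have "inj_on (\<lambda>w. c (?i w)) t"
      using comp_inj_on[of ?i t c] inj_on_subset[OF c] by (simp add: o_def)
    then have "Poly_Mapping.lookup (\<Sum>w\<in>t. frag_cmul (u w) (frag_of (c (?i w)))) (c (?i v)) = u v"
      using frag_lookup_sum[OF t(1)] v by blast
    also have "(\<Sum>w\<in>t. frag_cmul (u w) (frag_of (c (?i w)))) =
        frag_extend \<psi> (\<Sum>w\<in>t. frag_cmul (u w) w)"
    proof -
      have "frag_of (c (?i w)) = frag_extend \<psi> w" if "w \<in> t" for w
        using \<psi>[of "?i w"] that t(2) by (auto simp: inv_into_into f_inv_into_f)
      then show ?thesis by (simp add: frag_extend_sum[OF t(1)] frag_extend_cmul)
    qed
    finally show "u v = 0" using 0 by simp
  qed
qed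


section \<open>The indices form a basis\<close>

theorem theorem3p6:
  fixes C :: "('k::alg_closed_field, 'o, 'm::ab_group_add) tricat"
    and \<R> \<R>' I :: "'o set"
  assumes "triangulated_category C"
    and "hom_finite C"
    and "krull_remak_schmidt C"
    and "two_calabi_yau C"
    and "maximal_rigid C \<R>" and "functorially_finite C \<R>"
    and "maximal_rigid C \<R>'" and "functorially_finite C \<R>'"
    and "indec_representatives C \<R>' I"
  shows "is_int_basis (ind C \<R>) I (K0_split C \<R>)"
proof -
  interpret krull_schmidt_triangulated_category C
    by (intro krull_schmidt_triangulated_category.intro krull_schmidt_triangulated_category_axioms.intro
        assms)
  interpret F: module frag_cmul by (rule module_frag_cmul)
  have CY: "two_calabi_yau C" by (rule assms(4))
  have \<R>: "maximal_rigid C \<R>" "contravariantly_finite C \<R>"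
    and \<R>': "maximal_rigid C \<R>'" "contravariantly_finite C \<R>'"
    using assms(5-8) unfolding functorially_finite_def by blast+
  have rigid: "rigid_subcategory C \<R>" "rigid_subcategory C \<R>'"
    using \<R> \<R>' unfolding maximal_rigid_def by blast+
  have add: "additive_subcategory C \<R>" "additive_subcategory C \<R>'"
    using rigid unfolding rigid_subcategory_def by blast+
  have index: "has_index C \<R> Y (ind C \<R> Y)" if "Y \<in> \<R>'" for Y
    using maximal_rigid_has_index[OF CY \<R> member_Ext1_vanishes[OF rigid(2) that]] .
  have I: "I \<subseteq> \<R>'" "\<And>Y. Y \<in> I \<Longrightarrow> indecomposable C Y"
    and rep: "\<And>Y. Y \<in> \<R>' \<Longrightarrow> indecomposable C Y \<Longrightarrow> \<exists>!Z. Z \<in> I \<and> isomorphic C Y Z"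
    using assms(9) unfolding indec_representatives_def by blast+

  obtain \<psi> where \<psi>: "\<And>Y. Y \<in> \<R>' \<Longrightarrow> frag_extend \<psi> (ind C \<R> Y) = K0_class C Y"
    using index_left_inverse[OF CY \<R> \<R>'] by blast
  have "inj_on (iso_class C) I"
  proof (rule inj_onI)
    fix Y Z assume YZ: "Y \<in> I" "Z \<in> I" "iso_class C Y = iso_class C Z"
    have "\<exists>!Z. Z \<in> I \<and> isomorphic C Y Z" using rep I YZ(1) by blast
    then show "Y = Z" using YZ iso_class_eq_iff isomorphic_refl by blast
  qed
  moreover have "frag_extend \<psi> (ind C \<R> Y) = frag_of (iso_class C Y)" if "Y \<in> I" for Y
    using \<psi>[of Y] K0_class_indecomposable[OF I(2)[OF that]] I(1) that by auto
  ultimately have independent: "inj_on (ind C \<R>) I" "F.independent (ind C \<R> ` I)"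
    using independent_of_left_inverse[of I \<psi> "ind C \<R>" "iso_class C"] by blast+

  let ?S = "iso_class C ` {X \<in> \<R>. indecomposable C X}"
  have carrier: "carrier (K0_split C \<R>) = {x. Poly_Mapping.keys x \<subseteq> ?S}"
    unfolding K0_split_def by auto
  have subspace: "F.subspace (carrier (K0_split C \<R>))"
    unfolding carrier
  proof (rule F.subspaceI)
    fix x y :: "'o set \<Rightarrow>\<^sub>0 int"
    assume "x \<in> {x. Poly_Mapping.keys x \<subseteq> ?S}" "y \<in> {x. Poly_Mapping.keys x \<subseteq> ?S}"
    then show "x + y \<in> {x. Poly_Mapping.keys x \<subseteq> ?S}"
      using keys_add[of x y] by blast
  next
    fix n and x :: "'o set \<Rightarrow>\<^sub>0 int"
    assume "x \<in> {x. Poly_Mapping.keys x \<subseteq> ?S}"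
    then show "frag_cmul n x \<in> {x. Poly_Mapping.keys x \<subseteq> ?S}"
      using keys_cmul[of n x] by blast
  qed simp
  have "ind C \<R> Y \<in> carrier (K0_split C \<R>)" if "Y \<in> I" for Y
  proof -
    obtain R\<^sub>0 R\<^sub>1 where "R\<^sub>0 \<in> \<R>" "R\<^sub>1 \<in> \<R>" "ind C \<R> Y = K0_class C R\<^sub>0 - K0_class C R\<^sub>1"
      using index[of Y] \<open>Y \<in> I\<close> I(1) unfolding has_index_def by blast
    then show ?thesis
      using F.subspace_diff[OF subspace] K0_class_in_K0_split[OF add(1)] by simp
  qed
  then have sub: "F.span (ind C \<R> ` I) \<subseteq> carrier (K0_split C \<R>)"
    using F.span_minimal[OF _ subspace] by blast

  have span_index: "ind C \<R> A \<in> F.span (ind C \<R> ` I)" if A: "A \<in> \<R>'" for A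
  proof -
    obtain Ys where Ys: "direct_sum C A Ys" "\<forall>Y\<in>set Ys. indecomposable C Y" "set Ys \<subseteq> \<R>'"
      using add(2) A by (rule additive_decomposition)
    have "ind C \<R> Y \<in> F.span (ind C \<R> ` I)" if "Y \<in> set Ys" for Y
    proof -
      obtain Z where Z: "Z \<in> I" "isomorphic C Y Z" using rep Ys(2,3) \<open>Y \<in> set Ys\<close> by blast
      have "ind C \<R> Z = ind C \<R> Y"
        using ind_eq[OF rigid(1) has_index_iso[OF rigid(1) index Z(2)]] Ys(3) that by blast
      then show ?thesis using F.span_base[OF imageI[OF Z(1)], of "ind C \<R>"] by simp
    qed
    then have "(\<Sum>Y\<leftarrow>Ys. ind C \<R> Y) \<in> F.span (ind C \<R> ` I)"
      by (induction Ys) (auto intro: F.span_zero F.span_add)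
    moreover have "ind C \<R> A = (\<Sum>Y\<leftarrow>Ys. ind C \<R> Y)"
      using ind_eq[OF rigid(1) has_index_sum_list[OF rigid(1) Ys(1)]] index Ys(3) by blast
    ultimately show ?thesis by simp
  qed
  have "x \<in> F.span (ind C \<R> ` I)" if "Poly_Mapping.keys x \<subseteq> ?S" for x
    using that
  proof (induction x rule: frag_induction)
    case (one c)
    then obtain X where X: "X \<in> \<R>" "indecomposable C X" "c = iso_class C X" by blast
    obtain A B where "A \<in> \<R>'" "B \<in> \<R>'" "K0_class C X = ind C \<R> A - ind C \<R> B"
      using CY \<R> \<R>' X(1) by (rule K0_class_as_index_difference)
    then show ?case
      using F.span_diff[OF span_index span_index] K0_class_indecomposable[OF X(2)] X(3) by simp
  qed (auto intro: F.span_zero F.span_diff)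
  then have "F.span (ind C \<R> ` I) = carrier (K0_split C \<R>)"
    using sub carrier by blast
  then show ?thesis
    unfolding is_int_basis_def using independent by simp
qed

end
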